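(* Let $k\ge 1$ be an integer and let $G$ be a finite simple $2$-connected non-bipartite graph which is not $3$-connected. If the minimum degree of $G$ is at least $k+1$, then $G$ contains $\lceil k/2\rceil$ cycles with consecutive odd lengths, i.e. there is an odd integer $\ell$ such that $G$ contains, for each $i\in\{0,1,\dots,\lceil k/2\rceil-1\}$, a cycle of length $\ell+2i$.
   Context: All graphs are finite, simple and undirected. The length of a cycle is its number of edges. *)

theory Defs
  imports Complex_Main "Graph_Theory.Digraph_Component"
begin

text \<open>
  A finite simple undirected graph is a \<^locale>\<open>pair_graph\<close>: a finite loop-free symmetric digraph
  without parallel arcs, in which each undirected edge is represented by its two orientations.
\<close>

text \<open>
  By symmetry the out-degree of a vertex is the number of its neighbours. The minimum is taken over
  a finite set, and is meaningful only for a nonempty vertex set.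
\<close>

definition min_degree :: "('a, 'b) pre_digraph \<Rightarrow> nat" where
  "min_degree G = Min (out_degree G ` verts G)"

definition bipartite :: "('a, 'b) pre_digraph \<Rightarrow> bool" where
  "bipartite G \<longleftrightarrow>
     (\<exists>A B. A \<union> B = verts G \<and> A \<inter> B = {} \<and> arcs_ends G \<subseteq> A \<times> B \<union> B \<times> A)"

definition vertex_connected :: "nat \<Rightarrow> ('a, 'b) pre_digraph \<Rightarrow> bool" where
  "vertex_connected k G \<longleftrightarrow>
     k < card (verts G) \<and>
     (\<forall>S \<subseteq> verts G. card S < k \<longrightarrow> connected (G \<restriction> (verts G - S)))"

text \<open>
  The bound excludes the directed 2-cycles formed by the two orientations of a single edge, which
  \<^const>\<open>pre_digraph.cycle\<close> admits. A directed cycle of length at least 3 traverses pairwise distinct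
  undirected edges, so its length is the number of edges of the undirected cycle.
\<close>

definition has_cycle_of_length :: "('a, 'b) pre_digraph \<Rightarrow> nat \<Rightarrow> bool" where
  "has_cycle_of_length G n \<longleftrightarrow> 3 \<le> n \<and> (\<exists>p. pre_digraph.cycle G p \<and> length p = n)"

end

theory Submission
  imports Defs
begin

text \<open>
  Let \<open>m = \<lceil>k/2\<rceil>\<close>, so that all degrees are at least \<open>2m\<close>, let \<open>{x, y}\<close> be a separating pair,
  and let \<open>A\<close>, \<open>B\<close> be the two sides. The main point is that each side contains \<open>m\<close> paths from \<open>x\<close>
  to \<open>y\<close> whose lengths form an arithmetic progression with difference 2. If one side, with the edge
  \<open>xy\<close> if present, has \<open>x\<close>-\<open>y\<close> paths of both parities, one of them closes the family of the other
  side to odd cycles. Otherwise both sides are bipartite. Since the whole graph is not, their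
  colourings disagree on whether \<open>x\<close> and \<open>y\<close> have the same colour, so a path of one side closes the
  family of the other side to odd cycles.

  The path families are found by induction on the number of vertices, for graphs that become
  2-connected when \<open>xy\<close> is added. Choose a complete bipartite subgraph with classes \<open>X\<close>
  containing \<open>x\<close> but not \<open>y\<close>, and \<open>Y\<close> the common neighbourhood of \<open>X\<close>, such that
  \<open>s = |X| \<le> |Y|\<close> is maximal. By maximality a vertex outside has at most \<open>s - 1\<close> neighbours in \<open>X\<close>
  and at most \<open>s\<close> in \<open>Y\<close>, so contracting the subgraph costs at most \<open>2s - 2\<close> degrees, while the
  \<open>s\<close> lengths \<open>1, 3, \<dots>, 2s - 1\<close> of paths from \<open>x\<close> to a vertex of \<open>Y\<close> gain \<open>s - 1\<close> further
  path lengths. The induction also demands that all paths of the family share their last edge,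
  which makes contraction at \<open>y\<close> possible. Choosing the component of \<open>y\<close> outside the subgraph as
  large as possible handles the configurations in which this component is useless.
\<close>

section \<open>Simple paths and connectivity\<close>

inductive spath :: "('a \<Rightarrow> 'a \<Rightarrow> bool) \<Rightarrow> 'a set \<Rightarrow> 'a \<Rightarrow> 'a \<Rightarrow> nat \<Rightarrow> bool"
  for E where
  refl: "u \<in> A \<Longrightarrow> spath E A u u 0"
| step: "u \<in> A \<Longrightarrow> E u v \<Longrightarrow> spath E (A - {u}) v w n \<Longrightarrow> spath E A u w (Suc n)"

lemma spath_endpoints:
  assumes "spath E A u v n"
  shows "u \<in> A" "v \<in> A"
  using assms by (induction rule: spath.induct) auto

lemma spath_mono: "spath E A u v n \<Longrightarrow> A \<subseteq> B \<Longrightarrow> spath E B u v n"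
proof (induction arbitrary: B rule: spath.induct)
  case (step u A v w n)
  then have "spath E (B - {u}) v w n" by (meson Diff_mono subset_refl)
  then show ?case using step by (intro spath.step) auto
qed (auto intro: spath.refl)

lemma spath_mono_rel:
  "spath E A u v n \<Longrightarrow> (\<And>a b. a \<in> A \<Longrightarrow> b \<in> A \<Longrightarrow> E a b \<Longrightarrow> F a b) \<Longrightarrow> spath F A u v n"
proof (induction rule: spath.induct)
  case (step u A v w n)
  have "v \<in> A" using spath_endpoints(1)[OF step.hyps(3)] by simp
  then show ?case by (intro spath.step[of u A F v]) (use step in auto)
qed (auto intro: spath.refl)

lemma spath_append:
  "spath E A u v n \<Longrightarrow> spath E B v w k \<Longrightarrow> A \<inter> B \<subseteq> {v} \<Longrightarrow> spath E (A \<union> B) u w (n + k)"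
proof (induction rule: spath.induct)
  case (refl u A)
  then show ?case by (auto intro: spath_mono)
next
  case (step u A v' v n)
  have "v \<in> A - {u}" using spath_endpoints(2)[OF step.hyps(3)] .
  then have "A \<union> B - {u} = (A - {u}) \<union> B" using step.hyps(1) step.prems(2) by auto
  moreover have "spath E ((A - {u}) \<union> B) v' w (n + k)" using step by (intro step.IH) auto
  ultimately show ?case using step.hyps(1,2) spath.step[of u "A \<union> B" E v' w "n + k"] by simp
qed

lemma spath_edge: "E u v \<Longrightarrow> u \<noteq> v \<Longrightarrow> spath E {u, v} u v 1"
  using spath.step[of u "{u, v}" E v v 0] by (auto intro: spath.refl)

lemma spath_join:
  assumes "spath E A u v n" "E v v'" "spath E B v' w k" "A \<inter> B = {}"
  shows "spath E (A \<union> B) u w (Suc (n + k))"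
proof -
  have v: "v \<in> A" "v \<notin> B" using assms(4) spath_endpoints(2)[OF assms(1)] by auto
  have "spath E (insert v B) v w (Suc k)" using assms v by (intro spath.step[of v _ E v']) auto
  then have "spath E (A \<union> insert v B) u w (n + Suc k)"
    using assms by (intro spath_append[of E A u v]) auto
  then show ?thesis using v by (simp add: insert_absorb)
qed

lemma spath_rev:
  assumes "symp E" "spath E A u v n"
  shows "spath E A v u n"
  using assms(2)
proof (induction rule: spath.induct)
  case (step u A v w n)
  have "E v u" using step.hyps(2) by (rule sympD[OF assms(1)])
  then have "spath E ((A - {u}) \<union> {u}) w u (Suc (n + 0))"
    using step.IH by (intro spath_join[of E _ w v]) (auto intro: spath.refl)
  then show ?case using step.hyps(1) by (simp add: insert_absorb)
qed (rule spath.refl)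

lemma spath_split_last:
  assumes "symp E" "spath E A u v n" "u \<noteq> v"
  obtains w k where "n = Suc k" "spath E (A - {v}) u w k" "E w v"
  using spath_rev[OF assms(1,2)]
proof cases
  case (step w k)
  show thesis
    using that[OF step(1) spath_rev[OF assms(1) step(4)] sympD[OF assms(1) step(3)]] .
qed (use assms in auto)

definition joined :: "('a \<Rightarrow> 'a \<Rightarrow> bool) \<Rightarrow> 'a set \<Rightarrow> 'a \<Rightarrow> 'a \<Rightarrow> bool" where
  "joined E A u v \<longleftrightarrow> (\<exists>n. spath E A u v n)"

lemma joined_refl: "u \<in> A \<Longrightarrow> joined E A u u"
  unfolding joined_def using spath.refl by metis

lemma joined_sym: "symp E \<Longrightarrow> joined E A u v \<Longrightarrow> joined E A v u"
  unfolding joined_def using spath_rev by metis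

lemma joined_mono: "joined E A u v \<Longrightarrow> A \<subseteq> B \<Longrightarrow> joined E B u v"
  unfolding joined_def using spath_mono by metis

lemma joined_extend:
  assumes "joined E A u v" "E v w" "w \<in> A"
  shows "joined E A u w"
proof -
  obtain n where "spath E A u v n" using assms(1) unfolding joined_def by blast
  then show ?thesis using assms(2,3)
  proof (induction rule: spath.induct)
    case (refl u A)
    show ?case
    proof (cases "w = u")
      case False
      then have "spath E A u w (Suc 0)" using refl by (intro spath.step[OF _ _ spath.refl]) auto
      then show ?thesis unfolding joined_def by blast
    qed (use refl in \<open>auto intro: joined_refl\<close>)
  next
    case (step u A v v' n)
    show ?case
    proof (cases "w = u")
      case False
      then obtain k where "spath E (A - {u}) v w k" using step unfolding joined_def by auto
      then have "spath E A u w (Suc k)" using step.hyps(1,2) by (intro spath.step)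
      then show ?thesis unfolding joined_def by blast
    qed (use step in \<open>auto intro: joined_refl\<close>)
  qed
qed

lemma joined_edge: "E u v \<Longrightarrow> u \<in> A \<Longrightarrow> v \<in> A \<Longrightarrow> joined E A u v"
  by (rule joined_extend[of E A u u]) (auto intro: joined_refl)

lemma joined_closed:
  assumes "joined E A u v" "u \<in> C" "\<And>a b. a \<in> C \<Longrightarrow> b \<in> A \<Longrightarrow> E a b \<Longrightarrow> b \<in> C"
  shows "v \<in> C"
proof -
  obtain n where "spath E A u v n" using assms(1) unfolding joined_def by blast
  then show ?thesis using assms(2,3)
  proof (induction rule: spath.induct)
    case (step u A v w n)
    then show ?case using spath_endpoints(1)[OF step.hyps(3)] by (metis DiffD1)
  qed auto
qed

lemma joined_trans: "joined E A u v \<Longrightarrow> joined E A v w \<Longrightarrow> joined E A u w"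
  using joined_closed[of E A v w "{t. joined E A u t}"] joined_extend by fastforce

definition boundary :: "('a \<Rightarrow> 'a \<Rightarrow> bool) \<Rightarrow> 'a set \<Rightarrow> 'a set \<Rightarrow> 'a set" where
  "boundary E V S = {t \<in> V - S. \<exists>u\<in>S. E u t}"

lemma boundary_Diff: "boundary E (V - T) S = boundary E V S - T"
  unfolding boundary_def by auto

definition connected_on :: "('a \<Rightarrow> 'a \<Rightarrow> bool) \<Rightarrow> 'a set \<Rightarrow> bool" where
  "connected_on E W \<longleftrightarrow> (\<forall>u\<in>W. \<forall>v\<in>W. joined E W u v)"

lemma connected_on_boundary:
  assumes "connected_on E W" "S \<subset> W" "S \<noteq> {}"
  shows "boundary E W S \<noteq> {}"
proof
  assume empty: "boundary E W S = {}"
  obtain u v where uv: "u \<in> S" "v \<in> W - S" using assms(2,3) by auto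
  then have "joined E W u v" using assms(1,2) unfolding connected_on_def by auto
  then have "v \<in> S" using uv(1) by (rule joined_closed) (use empty in \<open>auto simp: boundary_def\<close>)
  then show False using uv by auto
qed

lemma connected_onI:
  assumes "symp E" "c \<in> W" "\<And>S. S \<subseteq> W - {c} \<Longrightarrow> S \<noteq> {} \<Longrightarrow> boundary E W S \<noteq> {}"
  shows "connected_on E W"
proof -
  define S where "S = {v \<in> W. \<not> joined E W c v}"
  have "joined E W c c" using assms(2) by (rule joined_refl)
  have "S = {}"
  proof (rule ccontr)
    assume "S \<noteq> {}"
    moreover have "S \<subseteq> W - {c}" using \<open>joined E W c c\<close> unfolding S_def by blast
    ultimately obtain u t where "u \<in> S" "t \<in> W - S" "E u t"
      using assms(3)[of S] unfolding boundary_def by auto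
    then show False
      using joined_extend[of E W c t u] sympD[OF assms(1)] unfolding S_def by auto
  qed
  then have "joined E W c v" if "v \<in> W" for v using that unfolding S_def by auto
  then show ?thesis unfolding connected_on_def using joined_trans joined_sym[OF assms(1)] by metis
qed

lemma connected_on_Diff:
  assumes "symp E" "connected_on E W" "boundary E W S \<subseteq> {q}" "q \<in> W - S"
  shows "connected_on E (W - S)"
  using assms(1,4)
proof (rule connected_onI)
  fix T assume T: "T \<subseteq> W - S - {q}" "T \<noteq> {}"
  then have "T \<subset> W" using assms(4) by auto
  then obtain u t where ut: "u \<in> T" "t \<in> W - T" "E u t"
    using connected_on_boundary[OF assms(2) _ T(2)] unfolding boundary_def by auto
  have "t \<notin> S"
  proof
    assume "t \<in> S"
    then have "u \<in> boundary E W S"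
      using ut T sympD[OF assms(1)] unfolding boundary_def by auto
    then show False using assms(3) T ut(1) by auto
  qed
  then show "boundary E (W - S) T \<noteq> {}" using ut unfolding boundary_def by auto
qed

lemma boundary_complement_subset:
  assumes "symp E" "boundary E V S \<subseteq> {v}"
  shows "boundary E V (V - S - {v}) \<subseteq> {v}"
  using assms(2) sympD[OF assms(1)] unfolding boundary_def by blast

lemma connected_on_insert_boundary:
  assumes "symp E" "connected_on E V" "S \<subseteq> V" "boundary E V S = {v}"
  shows "connected_on E (insert v S)"
proof -
  have v: "v \<in> V - S" using assms(4) unfolding boundary_def by auto
  have "boundary E V (V - S - {v}) \<subseteq> {v}"
    using assms(1) by (rule boundary_complement_subset) (simp add: assms(4))
  with assms(1,2) have "connected_on E (V - (V - S - {v}))"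
    by (rule connected_on_Diff) (use v in auto)
  moreover have "V - (V - S - {v}) = insert v S" using v assms(3) by auto
  ultimately show ?thesis by simp
qed

definition component :: "('a \<Rightarrow> 'a \<Rightarrow> bool) \<Rightarrow> 'a set \<Rightarrow> 'a \<Rightarrow> 'a set" where
  "component E A c = {v \<in> A. joined E A c v}"

lemma component_subset: "component E A c \<subseteq> A"
  unfolding component_def by auto

lemma component_self: "c \<in> A \<Longrightarrow> c \<in> component E A c"
  unfolding component_def by (auto intro: joined_refl)

lemma component_step: "u \<in> component E A c \<Longrightarrow> t \<in> A \<Longrightarrow> E u t \<Longrightarrow> t \<in> component E A c"
  unfolding component_def by (auto intro: joined_extend)

lemma connected_on_component:
  assumes "symp E" "c \<in> A"
  shows "connected_on E (component E A c)"
  using assms(1) component_self[OF assms(2)]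
proof (rule connected_onI)
  fix S assume S: "S \<subseteq> component E A c - {c}" "S \<noteq> {}"
  then obtain v where v: "v \<in> S" "joined E A v c"
    unfolding component_def using joined_sym[OF assms(1)] by blast
  show "boundary E (component E A c) S \<noteq> {}"
  proof
    assume empty: "boundary E (component E A c) S = {}"
    have "c \<in> S"
      using v(2,1)
    proof (rule joined_closed)
      fix a b assume "a \<in> S" "b \<in> A" "E a b"
      then show "b \<in> S"
        using component_step[of a E A c b] S empty unfolding boundary_def by auto
    qed
    then show False using S by auto
  qed
qed

lemma connected_on_subset_component:
  "connected_on E W \<Longrightarrow> c \<in> W \<Longrightarrow> W \<subseteq> A \<Longrightarrow> W \<subseteq> component E A c"
  unfolding connected_on_def component_def by (auto intro: joined_mono)

text \<open>In a 2-connected graph this holds for every \<open>P\<close> that misses two vertices.\<close>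

definition two_exits :: "('a \<Rightarrow> 'a \<Rightarrow> bool) \<Rightarrow> 'a set \<Rightarrow> 'a set \<Rightarrow> bool" where
  "two_exits E V P \<longleftrightarrow> (\<forall>S \<subseteq> P. S \<noteq> {} \<longrightarrow> (\<forall>q. \<not> boundary E V S \<subseteq> {q}))"

lemma two_exitsD: "two_exits E V P \<Longrightarrow> S \<subseteq> P \<Longrightarrow> S \<noteq> {} \<Longrightarrow> \<not> boundary E V S \<subseteq> {q}"
  unfolding two_exits_def by blast

lemma two_exits_mono: "two_exits E V P \<Longrightarrow> Q \<subseteq> P \<Longrightarrow> two_exits E V Q"
  unfolding two_exits_def by blast

lemma two_exits_transfer:
  assumes "two_exits E V P" "\<And>u t. u \<in> P \<Longrightarrow> t \<in> V \<Longrightarrow> E u t \<Longrightarrow> t \<in> W \<and> F u t"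
  shows "two_exits F W P"
  unfolding two_exits_def
proof (intro allI impI)
  fix S q assume S: "S \<subseteq> P" "S \<noteq> {}"
  then have "boundary E V S \<subseteq> boundary F W S" using assms(2) unfolding boundary_def by blast
  then show "\<not> boundary F W S \<subseteq> {q}" using two_exitsD[OF assms(1) S, of q] by blast
qed

lemma two_exits_if_connected_on:
  assumes "\<And>q. connected_on E (V - {q})" "x \<in> V" "y \<in> V" "x \<noteq> y" "P \<subseteq> V - {x, y}"
  shows "two_exits E V P"
  unfolding two_exits_def
proof (intro allI impI notI)
  fix S q assume S: "S \<subseteq> P" "S \<noteq> {}" "boundary E V S \<subseteq> {q}"
  define r where "r = (if q \<in> S then x else q)"
  have "boundary E V S \<subseteq> {r}" using S(3) unfolding r_def boundary_def by auto
  then have "boundary E (V - {r}) S = {}" by (simp add: boundary_Diff)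
  moreover have "S \<subset> V - {r}"
  proof
    show "S \<subseteq> V - {r}" using S(1) assms(5) unfolding r_def by auto
    show "S \<noteq> V - {r}" using S(1) assms(2-5) by blast
  qed
  ultimately show False using connected_on_boundary[OF assms(1)] S(2) by blast
qed

lemma connected_on_if_two_exits:
  assumes "symp E" "two_exits E V (V - {x, y})" "x \<in> V" "x \<noteq> y"
  shows "connected_on E (V - {y})"
  using assms(1)
proof (rule connected_onI)
  fix S assume "S \<subseteq> V - {y} - {x}" "S \<noteq> {}"
  moreover from this have "S \<subseteq> V - {x, y}" by auto
  ultimately have "\<not> boundary E V S \<subseteq> {y}" using two_exitsD[OF assms(2)] by blast
  then show "boundary E (V - {y}) S \<noteq> {}" by (auto simp: boundary_Diff)
qed (use assms in auto)

section \<open>Families of paths with lengths in arithmetic progression\<close>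

definition prog_paths :: "('a \<Rightarrow> 'a \<Rightarrow> bool) \<Rightarrow> 'a set \<Rightarrow> 'a \<Rightarrow> 'a \<Rightarrow> nat \<Rightarrow> bool" where
  "prog_paths E A u v m \<longleftrightarrow> (\<exists>l. \<forall>i<m. spath E A u v (l + 2 * i))"

lemma prog_paths_mono: "prog_paths E A u v m \<Longrightarrow> A \<subseteq> B \<Longrightarrow> n \<le> m \<Longrightarrow> prog_paths E B u v n"
  unfolding prog_paths_def by (meson less_le_trans spath_mono)

lemma prog_paths_mono_rel:
  "prog_paths E A u v m \<Longrightarrow> (\<And>a b. a \<in> A \<Longrightarrow> b \<in> A \<Longrightarrow> E a b \<Longrightarrow> F a b) \<Longrightarrow> prog_paths F A u v m"
  unfolding prog_paths_def using spath_mono_rel by metis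

lemma prog_paths_rev: "symp E \<Longrightarrow> prog_paths E A u v m \<Longrightarrow> prog_paths E A v u m"
  unfolding prog_paths_def using spath_rev by metis

lemma prog_paths_append:
  assumes "prog_paths E A u v m" "spath E B v w k" "A \<inter> B \<subseteq> {v}"
  shows "prog_paths E (A \<union> B) u w m"
proof -
  obtain l where l: "\<forall>i<m. spath E A u v (l + 2 * i)"
    using assms unfolding prog_paths_def by auto
  have "spath E (A \<union> B) u w (l + k + 2 * i)" if "i < m" for i
    using spath_append[OF l[rule_format, OF that] assms(2,3)] by (simp add: ac_simps)
  then show ?thesis unfolding prog_paths_def by blast
qed

lemma prog_paths_sumI:
  assumes "\<And>i j. i < p \<Longrightarrow> j < r \<Longrightarrow> spath E A u v (l + 2 * i + 2 * j)"
    and "1 \<le> p" "1 \<le> r" "m + 1 \<le> p + r"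
  shows "prog_paths E A u v m"
proof -
  have "spath E A u v (l + 2 * k)" if "k < m" for k
  proof -
    define i where "i = min k (p - 1)"
    have i: "i < p" "k - i < r" "i \<le> k" using assms(2-4) that unfolding i_def by auto
    then have "l + 2 * i + 2 * (k - i) = l + 2 * k" by simp
    then show ?thesis using assms(1)[OF i(1,2)] by metis
  qed
  then show ?thesis unfolding prog_paths_def by blast
qed

lemma prog_paths_join:
  assumes "prog_paths E A u v p" "E v v'" "prog_paths E B v' w r" "A \<inter> B = {}"
    and "1 \<le> p" "1 \<le> r" "m + 1 \<le> p + r"
  shows "prog_paths E (A \<union> B) u w m"
proof -
  obtain a where a: "\<forall>i<p. spath E A u v (a + 2 * i)"
    using assms(1) unfolding prog_paths_def by auto
  obtain b where b: "\<forall>j<r. spath E B v' w (b + 2 * j)"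
    using assms(3) unfolding prog_paths_def by auto
  have "spath E (A \<union> B) u w (Suc (a + b) + 2 * i + 2 * j)" if "i < p" "j < r" for i j
    using spath_join[OF a[rule_format, OF that(1)] assms(2) b[rule_format, OF that(2)] assms(4)]
    by (simp add: ac_simps)
  then show ?thesis using assms(5-7) by (rule prog_paths_sumI)
qed

lemma prog_paths_one: "prog_paths E A u v 1 \<longleftrightarrow> joined E A u v"
  unfolding prog_paths_def joined_def by auto

definition biclique :: "('a \<Rightarrow> 'a \<Rightarrow> bool) \<Rightarrow> 'a set \<Rightarrow> 'a set \<Rightarrow> bool" where
  "biclique E X Y \<longleftrightarrow>
     finite X \<and> finite Y \<and> X \<inter> Y = {} \<and> (\<forall>a\<in>X. \<forall>b\<in>Y. E a b \<and> E b a)"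

lemma biclique_mono: "biclique E X Y \<Longrightarrow> X' \<subseteq> X \<Longrightarrow> Y' \<subseteq> Y \<Longrightarrow> biclique E X' Y'"
  unfolding biclique_def by (blast intro: finite_subset)

lemma biclique_spath_across:
  assumes "biclique E X Y" "x \<in> X" "a \<in> Y" "j < card X" "j < card Y"
  shows "spath E (X \<union> Y) x a (2 * j + 1)"
  using assms
proof (induction j arbitrary: X Y x)
  case 0
  then have "spath E {x, a} x a 1" by (intro spath_edge) (auto simp: biclique_def)
  then show ?case using 0 by (auto intro: spath_mono)
next
  case (Suc j)
  have "card (Y - {a}) \<noteq> 0" "card (X - {x}) \<noteq> 0"
    using Suc.prems by (auto simp: biclique_def)
  then obtain b x' where b: "b \<in> Y" "b \<noteq> a" and x': "x' \<in> X" "x' \<noteq> x"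
    by (metis DiffE card.empty ex_in_conv insertCI)
  have disj: "{x, b} \<inter> ((X - {x}) \<union> (Y - {b})) = {}"
    using Suc.prems b unfolding biclique_def by auto
  have "spath E {x, b} x b 1"
    using Suc.prems b by (intro spath_edge) (auto simp: biclique_def)
  moreover have "E b x'" using Suc.prems(1) b x' unfolding biclique_def by auto
  moreover have "spath E ((X - {x}) \<union> (Y - {b})) x' a (2 * j + 1)"
    using Suc.prems b x' by (intro Suc.IH) (auto intro: biclique_mono simp: biclique_def)
  ultimately have "spath E ({x, b} \<union> ((X - {x}) \<union> (Y - {b}))) x a (Suc (1 + (2 * j + 1)))"
    using disj by (rule spath_join)
  moreover have "{x, b} \<union> ((X - {x}) \<union> (Y - {b})) = X \<union> Y" using Suc.prems b by auto
  ultimately show ?case by simp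
qed

lemma biclique_prog_across:
  assumes "biclique E X Y" "x \<in> X" "a \<in> Y" "card X \<le> card Y"
  shows "prog_paths E (X \<union> Y) x a (card X)"
  unfolding prog_paths_def using biclique_spath_across[OF assms(1-3)] assms(4)
  by (intro exI[of _ 1]) (auto simp: add.commute)

lemma biclique_prog_within:
  assumes "biclique E X Y" "x \<in> X" "w \<in> X" "w \<noteq> x" "card X \<le> card Y"
  shows "prog_paths E (X \<union> Y) x w (card X - 1)"
proof -
  have "card X \<noteq> 0" using assms(1,2) unfolding biclique_def by auto
  then obtain a where a: "a \<in> Y" using assms(5) by fastforce
  have bi: "biclique E (X - {w}) Y" using assms(1) by (rule biclique_mono) auto
  have "prog_paths E ((X - {w}) \<union> Y) x a (card (X - {w}))"
    using assms a by (intro biclique_prog_across[OF bi]) (auto simp: biclique_def)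
  moreover have "spath E {a, w} a w 1"
    using assms a by (intro spath_edge) (auto simp: biclique_def)
  ultimately have "prog_paths E ((X - {w}) \<union> Y \<union> {a, w}) x w (card (X - {w}))"
    by (rule prog_paths_append) (use assms in \<open>auto simp: biclique_def\<close>)
  then show ?thesis by (rule prog_paths_mono) (use assms a in \<open>auto simp: biclique_def\<close>)
qed

section \<open>Rooted graphs\<close>

definition nbrs :: "'a set \<Rightarrow> ('a \<Rightarrow> 'a \<Rightarrow> bool) \<Rightarrow> 'a \<Rightarrow> 'a set" where
  "nbrs V E v = {u \<in> V. E v u}"

lemma card_nbrs_Int_le:
  assumes "card (nbrs V E v \<inter> A) \<le> n"
  shows "card (nbrs V E v \<inter> A) \<le> n * of_bool (\<exists>w\<in>A. E v w)"
proof (cases "\<exists>w\<in>A. E v w")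
  case False
  then have "nbrs V E v \<inter> A = {}" unfolding nbrs_def by auto
  then show ?thesis by simp
qed (use assms in simp)

lemma card_nbrs_Int_mono:
  "finite B \<Longrightarrow> card (nbrs V E v \<inter> B) \<le> n \<Longrightarrow> A \<subseteq> B \<Longrightarrow> card (nbrs V E v \<inter> A) \<le> n"
  using card_mono[of "nbrs V E v \<inter> B" "nbrs V E v \<inter> A"] by force

lemma ex_nbr_outside:
  assumes "finite X" "finite Z" "card X + card (nbrs V E v \<inter> Y) + card Z < card (nbrs V E v)"
  shows "\<exists>d\<in>V - (X \<union> Y \<union> Z). E v d"
proof (rule ccontr)
  assume "\<not> ?thesis"
  then have "nbrs V E v \<subseteq> X \<union> (nbrs V E v \<inter> Y) \<union> Z" unfolding nbrs_def by auto
  moreover have "finite (nbrs V E v)" using assms(3) card_ge_0_finite by force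
  ultimately have "card (nbrs V E v) \<le> card (X \<union> (nbrs V E v \<inter> Y) \<union> Z)"
    using assms(1,2) by (intro card_mono) auto
  also have "\<dots> \<le> card X + card (nbrs V E v \<inter> Y) + card Z"
    by (meson add_le_mono card_Un_le dual_order.trans order_refl)
  finally show False using assms(3) by linarith
qed

text \<open>The condition on the exits says that adding the edge \<open>xy\<close> makes the graph 2-connected.\<close>

definition rooted_graph :: "'a set \<Rightarrow> ('a \<Rightarrow> 'a \<Rightarrow> bool) \<Rightarrow> 'a \<Rightarrow> 'a \<Rightarrow> nat \<Rightarrow> bool" where
  "rooted_graph V E x y m \<longleftrightarrow>
     finite V \<and> x \<in> V \<and> y \<in> V \<and> x \<noteq> y \<and> symp E \<and> irreflp E \<and> \<not> E x y \<and> V \<noteq> {x, y} \<and>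
     two_exits E V (V - {x, y}) \<and> (m \<le> 1 \<or> (\<forall>v\<in>V - {x, y}. 2 * m \<le> card (nbrs V E v)))"

text \<open>All paths of the family enter \<open>y\<close> through the same neighbour \<open>g\<close>. This makes the family
  survive the expansion of a contracted set at \<open>y\<close>, which shifts the lengths by an amount depending
  on \<open>g\<close>.\<close>

definition shared_end_paths :: "'a set \<Rightarrow> ('a \<Rightarrow> 'a \<Rightarrow> bool) \<Rightarrow> 'a \<Rightarrow> 'a \<Rightarrow> nat \<Rightarrow> bool" where
  "shared_end_paths V E x y m \<longleftrightarrow> (\<exists>g\<in>V - {y}. E g y \<and> prog_paths E (V - {y}) x g m)"

lemma rooted_graph_sym: "rooted_graph V E x y m \<Longrightarrow> rooted_graph V E y x m"
  unfolding rooted_graph_def by (auto simp: insert_commute dest: sympD)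

lemma two_exits_nbr:
  assumes "two_exits E V (V - {x, y})" "V \<noteq> {x, y}" "x \<in> V" "y \<in> V"
  obtains g where "g \<in> V" "g \<noteq> x" "g \<noteq> y" "E g y"
proof -
  have "\<not> boundary E V (V - {x, y}) \<subseteq> {x}" using assms by (intro two_exitsD) auto
  then show ?thesis using that unfolding boundary_def by auto
qed

lemma shared_end_paths_le_one:
  assumes "rooted_graph V E x y m" "m \<le> 1"
  shows "shared_end_paths V E x y m"
proof -
  have G: "two_exits E V (V - {x, y})" "V \<noteq> {x, y}" "x \<in> V" "y \<in> V" "symp E" "x \<noteq> y"
    using assms unfolding rooted_graph_def by auto
  obtain g where g: "g \<in> V" "g \<noteq> y" "E g y" using two_exits_nbr[OF G(1-4)] by metis
  then have "joined E (V - {y}) x g"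
    using connected_on_if_two_exits[OF G(5,1,3,6)] G(3,6) unfolding connected_on_def by auto
  then have "prog_paths E (V - {y}) x g 1" unfolding prog_paths_one .
  then have "prog_paths E (V - {y}) x g m" by (rule prog_paths_mono[OF _ subset_refl assms(2)])
  then show ?thesis using g unfolding shared_end_paths_def by auto
qed

lemma shared_end_paths_append:
  assumes "symp E" "prog_paths E A x c m" "spath E B c y n" "A \<inter> B \<subseteq> {c}" "c \<noteq> y"
    "A \<union> B \<subseteq> V" "y \<notin> A"
  shows "shared_end_paths V E x y m"
proof -
  obtain g k where g: "spath E (B - {y}) c g k" "E g y"
    using spath_split_last[OF assms(1,3,5)] .
  have "prog_paths E (A \<union> (B - {y})) x g m"
    using assms g by (intro prog_paths_append[of E A x c]) auto
  then have "prog_paths E (V - {y}) x g m" by (rule prog_paths_mono) (use assms in auto)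
  moreover have "g \<in> B - {y}" using g spath_endpoints by metis
  ultimately show ?thesis using assms g unfolding shared_end_paths_def by auto
qed

section \<open>Contracting a set to a root\<close>

text \<open>The vertex \<open>x\<close>, which lies outside \<open>P\<close> and differs from \<open>c\<close>, stands for the contracted
  set \<open>T\<close>.\<close>

definition contract ::
  "('a \<Rightarrow> 'a \<Rightarrow> bool) \<Rightarrow> 'a set \<Rightarrow> 'a \<Rightarrow> 'a \<Rightarrow> 'a set \<Rightarrow> 'a \<Rightarrow> 'a \<Rightarrow> bool" where
  "contract E P c x T u v \<longleftrightarrow>
     u \<in> insert c P \<and> v \<in> insert c P \<and> E u v \<or>
     u = x \<and> v \<in> P \<and> (\<exists>w\<in>T. E v w) \<or> v = x \<and> u \<in> P \<and> (\<exists>w\<in>T. E u w)"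

lemma symp_contract: "symp E \<Longrightarrow> symp (contract E P c x T)"
  unfolding contract_def by (auto intro!: sympI dest: sympD)

lemma irreflp_contract: "irreflp E \<Longrightarrow> x \<notin> P \<Longrightarrow> irreflp (contract E P c x T)"
  unfolding contract_def by (auto intro!: irreflpI dest: irreflpD)

lemma card_nbrs_contract:
  assumes "finite P" "x \<notin> insert c P" "v \<in> P"
  shows "card (nbrs (insert x (insert c P)) (contract E P c x T) v) =
    card (nbrs (insert c P) E v) + of_bool (\<exists>w\<in>T. E v w)"
proof -
  have "nbrs (insert x (insert c P)) (contract E P c x T) v =
      nbrs (insert c P) E v \<union> (if \<exists>w\<in>T. E v w then {x} else {})"
    using assms(2,3) unfolding nbrs_def contract_def by auto
  moreover have "x \<notin> nbrs (insert c P) E v" "finite (nbrs (insert c P) E v)"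
    using assms(1,2) unfolding nbrs_def by auto
  ultimately show ?thesis by auto
qed

lemma two_exits_contract:
  assumes "x \<notin> insert c P" "c \<notin> P" "\<exists>p\<in>P. \<exists>w\<in>T. E p w" "\<exists>p\<in>P. E p c"
    and proper: "\<And>S q. S \<subset> P \<Longrightarrow> S \<noteq> {} \<Longrightarrow> \<not> boundary E (insert c P) S \<subseteq> {q}"
  shows "two_exits (contract E P c x T) (insert x (insert c P)) P"
  unfolding two_exits_def
proof (intro allI impI)
  fix S q assume S: "S \<subseteq> P" "S \<noteq> {}"
  let ?b = "boundary (contract E P c x T) (insert x (insert c P)) S"
  show "\<not> ?b \<subseteq> {q}"
  proof (cases "S = P")
    case True
    then have "x \<in> ?b" "c \<in> ?b"
      using assms(1-4) unfolding boundary_def contract_def by blast+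
    then show ?thesis using assms(1) by auto
  next
    case False
    have "boundary E (insert c P) S \<subseteq> ?b"
      using S(1) assms(1) unfolding boundary_def contract_def by blast
    then show ?thesis using proper[of S q] S False by blast
  qed
qed

section \<open>Vertex sets attached to a biclique\<close>

locale path_induction =
  fixes V :: "'a set" and E :: "'a \<Rightarrow> 'a \<Rightarrow> bool"
  assumes finite_V: "finite V" and symp_E: "symp E" and irreflp_E: "irreflp E"
    and smaller: "\<And>(W :: 'a set) F x y m. card W < card V \<Longrightarrow> rooted_graph W F x y m \<Longrightarrow>
      shared_end_paths W F x y m"
begin

lemma E_sym: "E a b \<Longrightarrow> E b a"
  using symp_E by (rule sympD)

lemma E_irr: "\<not> E a a"
  using irreflp_E by (rule irreflpD)

end

locale biclique_core = path_induction V E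
  for V :: "'a set" and E :: "'a \<Rightarrow> 'a \<Rightarrow> bool" +
  fixes x :: 'a and X Y :: "'a set"
  assumes X_subset: "X \<subseteq> V" and Y_subset: "Y \<subseteq> V" and biclique: "biclique E X Y" and x_in_X: "x \<in> X"
    and card_X_le_Y: "card X \<le> card Y"
begin

lemma finite_X: "finite X" and disjoint_X_Y: "X \<inter> Y = {}"
  using biclique unfolding biclique_def by auto

lemma card_X_pos: "0 < card X"
  using x_in_X finite_X card_gt_0_iff by blast

lemma Y_nonempty: "Y \<noteq> {}"
  using card_X_pos card_X_le_Y by auto

lemma core_joined:
  assumes "w \<in> X"
  shows "joined E (X \<union> Y) x w"
proof -
  obtain a where "a \<in> Y" using Y_nonempty by auto
  then have a: "E x a" "E a w" "a \<in> X \<union> Y"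
    using biclique x_in_X assms unfolding biclique_def by auto
  then have "joined E (X \<union> Y) x a" using x_in_X by (intro joined_edge) auto
  then show ?thesis using a(2) by (rule joined_extend) (use assms in simp)
qed

end

locale attachment = biclique_core V E x X Y
  for V :: "'a set" and E :: "'a \<Rightarrow> 'a \<Rightarrow> bool" and x :: 'a and X Y :: "'a set" +
  fixes m :: nat and P :: "'a set" and c :: 'a
  assumes P_subset: "P \<subseteq> V - (X \<union> Y)" and P_nonempty: "P \<noteq> {}" and c_in: "c \<in> V - (X \<union> Y \<union> P)"
    and nbrs_P: "\<And>p. p \<in> P \<Longrightarrow> nbrs V E p \<subseteq> insert c P \<union> X \<union> Y"
    and card_nbrs_X: "\<And>p. p \<in> P \<Longrightarrow> card (nbrs V E p \<inter> X) < card X"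
    and card_nbrs_Y: "\<And>p. p \<in> P \<Longrightarrow> card (nbrs V E p \<inter> Y) \<le> card X"
    and degree: "\<And>p. p \<in> P \<Longrightarrow> 2 * m \<le> card (nbrs V E p)"
    and exits: "two_exits E V P"
    and connected: "connected_on E (insert c P)"
begin

lemma finite_P: "finite P"
  using finite_subset[OF P_subset] finite_V by auto

lemma x_notin: "x \<notin> insert c P"
  using P_subset c_in x_in_X by auto

lemma core_disjoint: "(X \<union> Y) \<inter> insert c P = {}"
  using P_subset c_in by auto

lemma degree_split:
  assumes "p \<in> P"
  shows "2 * m \<le> card (nbrs (insert c P) E p) + card (nbrs V E p \<inter> X) + card (nbrs V E p \<inter> Y)"
proof -
  have "nbrs V E p = nbrs (insert c P) E p \<union> (nbrs V E p \<inter> X) \<union> (nbrs V E p \<inter> Y)"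
    using nbrs_P[OF assms] P_subset c_in unfolding nbrs_def by auto
  then have "card (nbrs V E p) \<le>
      card (nbrs (insert c P) E p) + card (nbrs V E p \<inter> X) + card (nbrs V E p \<inter> Y)"
    by (metis (no_types, lifting) add_le_mono1 card_Un_le dual_order.trans)
  then show ?thesis using degree[OF assms] by linarith
qed

definition cut_off :: "'a set \<Rightarrow> 'a \<Rightarrow> bool" where
  "cut_off S q \<longleftrightarrow> S \<subset> P \<and> S \<noteq> {} \<and> boundary E (insert c P) S \<subseteq> {q}"

lemma cut_off_boundary:
  assumes "cut_off S q"
  shows "boundary E (insert c P) S = {q}"
proof -
  have "S \<subset> insert c P" "S \<noteq> {}" "boundary E (insert c P) S \<subseteq> {q}"
    using assms unfolding cut_off_def by auto
  then show ?thesis using connected_on_boundary[OF connected] by blast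
qed

lemma cut_off_outside: "cut_off S q \<Longrightarrow> q \<in> insert c P - S"
  using cut_off_boundary[of S q] unfolding boundary_def by auto

lemma cut_off_rest_joined:
  assumes "cut_off S q"
  shows "joined E (insert c P - S) q c"
proof -
  have "connected_on E (insert c P - S)"
    using connected_on_Diff[OF symp_E connected] cut_off_boundary[OF assms]
      cut_off_outside[OF assms] by auto
  moreover have "c \<in> insert c P - S" using assms c_in unfolding cut_off_def by auto
  ultimately show ?thesis using cut_off_outside[OF assms] unfolding connected_on_def by auto
qed

lemma cut_off_attachment:
  assumes "cut_off S q"
  shows "attachment V E x X Y m S q"
proof unfold_locales
  have S: "S \<subset> P" "S \<noteq> {}" and q: "q \<in> insert c P - S"
    using assms cut_off_outside unfolding cut_off_def by auto
  have step: "t \<in> insert q S" if "u \<in> S" "t \<in> insert c P" "E u t" for u t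
    using that cut_off_boundary[OF assms] unfolding boundary_def by blast
  show "S \<subseteq> V - (X \<union> Y)" "S \<noteq> {}" "q \<in> V - (X \<union> Y \<union> S)" using S q P_subset c_in by auto
  show "two_exits E V S" using exits S by (auto intro: two_exits_mono)
  show "connected_on E (insert q S)"
    using symp_E connected _ cut_off_boundary[OF assms]
    by (rule connected_on_insert_boundary) (use S in auto)
  fix p assume p: "p \<in> S"
  then show "nbrs V E p \<subseteq> insert q S \<union> X \<union> Y" using nbrs_P[of p] step S unfolding nbrs_def by blast
  show "card (nbrs V E p \<inter> X) < card X" "card (nbrs V E p \<inter> Y) \<le> card X"
    "2 * m \<le> card (nbrs V E p)"
    using p S card_nbrs_X card_nbrs_Y degree by auto
qed

lemma cut_off_complement:
  assumes "cut_off S c"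
  shows "cut_off (P - S) c"
proof -
  have "insert c P - S - {c} = P - S" using c_in by auto
  then have "boundary E (insert c P) (P - S) \<subseteq> {c}"
    using boundary_complement_subset[OF symp_E, of "insert c P" S c] cut_off_boundary[OF assms]
    by simp
  then show ?thesis using assms unfolding cut_off_def by blast
qed

definition contractible :: "'a set \<Rightarrow> nat \<Rightarrow> bool" where
  "contractible T r \<longleftrightarrow> (\<exists>p\<in>P. \<exists>w\<in>T. E p w) \<and>
     (r \<le> 1 \<or> (\<forall>v\<in>P. 2 * r \<le> card (nbrs (insert c P) E v) + of_bool (\<exists>w\<in>T. E v w)))"

lemma contractible_maxI:
  assumes "\<exists>p\<in>P. \<exists>w\<in>T. E p w"
    and "\<And>v. v \<in> P \<Longrightarrow> 1 < r \<Longrightarrow> 2 * r \<le> card (nbrs (insert c P) E v) + of_bool (\<exists>w\<in>T. E v w)"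
  shows "contractible T (max 1 r)"
proof (cases "1 < r")
  case True
  then show ?thesis using assms unfolding contractible_def by auto
qed (use assms(1) in \<open>simp add: contractible_def max_def\<close>)

lemma contract_rooted_graph:
  assumes "\<nexists>S q. cut_off S q" "contractible T r"
  shows "rooted_graph (insert x (insert c P)) (contract E P c x T) c x r"
proof -
  have V': "insert x (insert c P) - {c, x} = P" using x_notin c_in by auto
  have "boundary E (insert c P) P \<noteq> {}"
    using P_nonempty c_in by (intro connected_on_boundary[OF connected]) auto
  then have "\<exists>p\<in>P. E p c" unfolding boundary_def by auto
  moreover have "\<not> boundary E (insert c P) S \<subseteq> {q}" if "S \<subset> P" "S \<noteq> {}" for S q
    using assms(1) that unfolding cut_off_def by auto
  ultimately have "two_exits (contract E P c x T) (insert x (insert c P)) P"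
    using assms(2) x_notin c_in unfolding contractible_def by (intro two_exits_contract) auto
  moreover have "r \<le> 1 \<or>
      (\<forall>v\<in>P. 2 * r \<le> card (nbrs (insert x (insert c P)) (contract E P c x T) v))"
    using assms(2) card_nbrs_contract[OF finite_P x_notin] unfolding contractible_def by auto
  moreover have "\<not> contract E P c x T c x" using x_notin c_in unfolding contract_def by auto
  moreover have "insert x (insert c P) \<noteq> {c, x}" using V' P_nonempty by auto
  ultimately show ?thesis
    unfolding rooted_graph_def V'
    using finite_P x_notin symp_contract[OF symp_E] irreflp_contract[OF irreflp_E] by auto
qed

lemma card_contract_less: "card (insert x (insert c P)) < card V"
proof -
  obtain b where "b \<in> Y" using Y_nonempty by auto
  then have "b \<in> V" "b \<notin> insert x (insert c P)"
    using Y_subset disjoint_X_Y x_in_X core_disjoint by auto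
  moreover have "insert x (insert c P) \<subseteq> V" using P_subset c_in x_in_X X_subset by auto
  ultimately show ?thesis using finite_V by (intro psubset_card_mono) auto
qed

lemma contracted_paths_to_x:
  assumes "\<nexists>S q. cut_off S q" "contractible T r"
  obtains g w where "g \<in> P" "w \<in> T" "E w g" "prog_paths E (insert c P) g c r"
proof -
  let ?C = "contract E P c x T"
  have "shared_end_paths (insert x (insert c P)) ?C c x r"
    using smaller[OF card_contract_less contract_rooted_graph[OF assms]] .
  moreover have "insert x (insert c P) - {x} = insert c P" using x_notin by auto
  ultimately obtain g where g: "g \<in> insert c P" "?C g x" "prog_paths ?C (insert c P) c g r"
    unfolding shared_end_paths_def by auto
  have "prog_paths E (insert c P) c g r"
    using g(3) by (rule prog_paths_mono_rel) (use x_notin in \<open>auto simp: contract_def\<close>)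
  then have "prog_paths E (insert c P) g c r" by (rule prog_paths_rev[OF symp_E])
  moreover obtain w where "w \<in> T" "E w g" "g \<in> P"
    using g(1,2) x_notin E_sym unfolding contract_def by auto
  ultimately show ?thesis using that by blast
qed

lemma contracted_prog_join:
  assumes "\<nexists>S q. cut_off S q" "contractible T r"
    and "\<And>w. w \<in> T \<Longrightarrow> prog_paths E (X \<union> Y) x w p" "1 \<le> p" "1 \<le> r" "m + 1 \<le> p + r"
  shows "prog_paths E (X \<union> Y \<union> insert c P) x c m"
proof -
  obtain g w where gw: "g \<in> P" "w \<in> T" "E w g" "prog_paths E (insert c P) g c r"
    using contracted_paths_to_x[OF assms(1,2)] .
  show ?thesis
    using prog_paths_join[OF assms(3)[OF gw(2)] gw(3,4) core_disjoint assms(4-6)] .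
qed

lemma contractible_Y:
  assumes "\<exists>p\<in>P. \<exists>w\<in>Y. E p w"
  shows "contractible Y (max 1 (m + 1 - card X))"
  using assms
proof (rule contractible_maxI)
  fix v assume v: "v \<in> P" "1 < m + 1 - card X"
  have "card (nbrs V E v \<inter> Y) \<le> card X * of_bool (\<exists>w\<in>Y. E v w)"
    using card_nbrs_Int_le[OF card_nbrs_Y[OF v(1)]] .
  then show "2 * (m + 1 - card X) \<le> card (nbrs (insert c P) E v) + of_bool (\<exists>w\<in>Y. E v w)"
    using degree_split[OF v(1)] card_nbrs_X[OF v(1)] v(2) by (cases "\<exists>w\<in>Y. E v w") auto
qed

lemma degree_split_no_Y:
  assumes "\<nexists>p w. p \<in> P \<and> w \<in> Y \<and> E p w" "v \<in> P"
  shows "2 * m \<le> card (nbrs (insert c P) E v) + card (nbrs V E v \<inter> X)"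
proof -
  have "nbrs V E v \<inter> Y = {}" using assms unfolding nbrs_def by auto
  then show ?thesis using degree_split[OF assms(2)] by simp
qed

lemma contractible_X:
  assumes "\<nexists>p w. p \<in> P \<and> w \<in> Y \<and> E p w"
    and "card X \<le> 2 \<or> (\<nexists>p w. p \<in> P \<and> w \<in> X - {x} \<and> E p w)"
  shows "contractible X (max 1 m)"
proof (rule contractible_maxI)
  have "\<not> boundary E V P \<subseteq> {c}" by (rule two_exitsD[OF exits subset_refl P_nonempty])
  then obtain p t where "p \<in> P" "t \<in> V" "t \<notin> P" "t \<noteq> c" "E p t" unfolding boundary_def by auto
  then show "\<exists>p\<in>P. \<exists>w\<in>X. E p w" using nbrs_P[of p] assms(1) unfolding nbrs_def by blast
  fix v assume v: "v \<in> P"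
  have "card (nbrs V E v \<inter> X) \<le> 1"
  proof (cases "card X \<le> 2")
    case False
    then have "nbrs V E v \<inter> X \<subseteq> {x}" using assms(2) v unfolding nbrs_def by auto
    then show ?thesis using card_mono[of "{x}"] by auto
  qed (use card_nbrs_X[OF v] in auto)
  then have "card (nbrs V E v \<inter> X) \<le> 1 * of_bool (\<exists>w\<in>X. E v w)" by (rule card_nbrs_Int_le)
  then show "2 * m \<le> card (nbrs (insert c P) E v) + of_bool (\<exists>w\<in>X. E v w)"
    using degree_split_no_Y[OF assms(1) v] by linarith
qed

lemma contractible_X_minus_x:
  assumes "\<nexists>p w. p \<in> P \<and> w \<in> Y \<and> E p w" "2 < card X" "\<exists>p\<in>P. \<exists>w\<in>X - {x}. E p w"
  shows "contractible (X - {x}) (max 1 (m + 2 - card X))"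
  using assms(3)
proof (rule contractible_maxI)
  fix v assume v: "v \<in> P" "1 < m + 2 - card X"
  note degree_v = degree_split_no_Y[OF assms(1) v(1)]
  show "2 * (m + 2 - card X) \<le> card (nbrs (insert c P) E v) + of_bool (\<exists>w\<in>X - {x}. E v w)"
  proof (cases "\<exists>w\<in>X - {x}. E v w")
    case True
    then show ?thesis using degree_v card_nbrs_X[OF v(1)] assms(2) v(2) by auto
  next
    case False
    then have "nbrs V E v \<inter> X \<subseteq> {x}" unfolding nbrs_def by auto
    then have "card (nbrs V E v \<inter> X) \<le> 1" using card_mono[of "{x}"] by auto
    then show ?thesis using degree_v assms(2) v(2) by auto
  qed
qed

lemma spath_expand_Y:
  assumes "spath (contract E P c x Y) (insert x P) x g n" "g \<in> P" "j < card X"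
  shows "spath E (X \<union> Y \<union> P) x g (2 * j + 1 + n)"
  using assms(1)
proof cases
  case (step v k)
  have "insert x P - {x} = P" using x_notin by auto
  then have "spath (contract E P c x Y) P v g k" using step(4) by simp
  then have "spath E P v g k"
    by (rule spath_mono_rel) (use x_notin in \<open>auto simp: contract_def\<close>)
  moreover obtain w where w: "w \<in> Y" "E w v"
    using step(3) x_notin E_sym unfolding contract_def by auto
  moreover have "spath E (X \<union> Y) x w (2 * j + 1)"
    using biclique_spath_across[OF biclique x_in_X w(1) assms(3)] assms(3) card_X_le_Y by auto
  ultimately have "spath E (X \<union> Y \<union> P) x g (Suc (2 * j + 1 + k))"
    using core_disjoint by (intro spath_join[where v = w and v' = v]) auto
  then show ?thesis using step(1) by simp
qed (use assms(2) x_notin in auto)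

lemma shared_end_if_no_cut_off:
  assumes "\<nexists>S q. cut_off S q" "\<exists>p\<in>P. \<exists>w\<in>Y. E p w"
  shows "\<exists>g\<in>P. E g c \<and> prog_paths E (X \<union> Y \<union> P) x g m"
proof -
  let ?r = "max 1 (m + 1 - card X)" and ?C = "contract E P c x Y"
  have "rooted_graph (insert x (insert c P)) ?C c x ?r"
    using contract_rooted_graph[OF assms(1) contractible_Y[OF assms(2)]] .
  then have "shared_end_paths (insert x (insert c P)) ?C x c ?r"
    using smaller[OF card_contract_less rooted_graph_sym] by blast
  moreover have "insert x (insert c P) - {c} = insert x P" using x_notin c_in by auto
  ultimately obtain g l where g: "g \<in> insert x P" "?C g c"
    and l: "\<And>i. i < ?r \<Longrightarrow> spath ?C (insert x P) x g (l + 2 * i)"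
    unfolding shared_end_paths_def prog_paths_def by auto
  have gP: "g \<in> P" "E g c" using g x_notin c_in unfolding contract_def by auto
  have "spath E (X \<union> Y \<union> P) x g (Suc l + 2 * j + 2 * i)" if "j < card X" "i < ?r" for j i
    using spath_expand_Y[OF l[OF that(2)] gP(1) that(1)] by (simp add: ac_simps)
  then have "prog_paths E (X \<union> Y \<union> P) x g m"
    by (rule prog_paths_sumI) (use card_X_pos in auto)
  then show ?thesis using gP by blast
qed

text \<open>\<open>Y\<close>, \<open>X\<close> or \<open>X - {x}\<close> is contracted to \<open>x\<close>. In the last two cases the induction hypothesis is
  applied from \<open>c\<close> to \<open>x\<close>: sharing the last edge means that all paths reach the same vertex of the
  biclique.\<close>

lemma prog_paths_if_no_cut_off:
  assumes "\<nexists>S q. cut_off S q"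
  shows "prog_paths E (X \<union> Y \<union> insert c P) x c m"
proof -
  consider (Y) "\<exists>p\<in>P. \<exists>w\<in>Y. E p w"
    | (X) "\<nexists>p w. p \<in> P \<and> w \<in> Y \<and> E p w" "card X \<le> 2 \<or> (\<nexists>p w. p \<in> P \<and> w \<in> X - {x} \<and> E p w)"
    | (X_minus_x) "\<nexists>p w. p \<in> P \<and> w \<in> Y \<and> E p w" "2 < card X" "\<exists>p\<in>P. \<exists>w\<in>X - {x}. E p w"
    by (meson linorder_not_less)
  then show ?thesis
  proof cases
    case Y
    then obtain g where g: "g \<in> P" "E g c" "prog_paths E (X \<union> Y \<union> P) x g m"
      using shared_end_if_no_cut_off[OF assms] by blast
    have "g \<noteq> c" using g(1) c_in by auto
    then have "spath E {g, c} g c 1" using g(2) by (intro spath_edge)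
    then have "prog_paths E (X \<union> Y \<union> P \<union> {g, c}) x c m"
      by (rule prog_paths_append[OF g(3)]) (use c_in in auto)
    then show ?thesis by (rule prog_paths_mono) (use g in auto)
  next
    case X
    have "prog_paths E (X \<union> Y) x w 1" if "w \<in> X" for w
      unfolding prog_paths_one using that by (rule core_joined)
    with assms contractible_X[OF X] show ?thesis by (rule contracted_prog_join) auto
  next
    case X_minus_x
    have "prog_paths E (X \<union> Y) x w (card X - 1)" if "w \<in> X - {x}" for w
      using that by (intro biclique_prog_within[OF biclique x_in_X _ _ card_X_le_Y]) auto
    with assms contractible_X_minus_x[OF X_minus_x] show ?thesis
      by (rule contracted_prog_join) (use X_minus_x(2) in auto)
  qed
qed

lemma prog_paths_through_cut:
  assumes "cut_off S q" "prog_paths E (X \<union> Y \<union> insert q S) x q m"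
  shows "prog_paths E (X \<union> Y \<union> insert c P) x c m"
proof -
  obtain n where "spath E (insert c P - S) q c n"
    using cut_off_rest_joined[OF assms(1)] unfolding joined_def by blast
  then have "prog_paths E (X \<union> Y \<union> insert q S \<union> (insert c P - S)) x c m"
    by (rule prog_paths_append[OF assms(2)]) (use core_disjoint in auto)
  then show ?thesis
    by (rule prog_paths_mono)
      (use assms(1) cut_off_outside[OF assms(1)] in \<open>auto simp: cut_off_def\<close>)
qed

lemma shared_end_through_cut:
  assumes "cut_off S q" "q \<noteq> c" "prog_paths E (X \<union> Y \<union> insert q S) x q m"
  shows "\<exists>g\<in>P. E g c \<and> prog_paths E (X \<union> Y \<union> P) x g m"
proof -
  obtain n where "spath E (insert c P - S) q c n"
    using cut_off_rest_joined[OF assms(1)] unfolding joined_def by blast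
  then obtain g k where g: "spath E (insert c P - S - {c}) q g k" "E g c"
    using spath_split_last[OF symp_E _ assms(2)] by metis
  have "prog_paths E (X \<union> Y \<union> insert q S \<union> (insert c P - S - {c})) x g m"
    using assms(3) g(1) by (rule prog_paths_append) (use core_disjoint in auto)
  then have "prog_paths E (X \<union> Y \<union> P) x g m"
    by (rule prog_paths_mono)
      (use assms(1,2) cut_off_outside[OF assms(1)] in \<open>auto simp: cut_off_def\<close>)
  moreover have "g \<in> P" using spath_endpoints(2)[OF g(1)] by auto
  ultimately show ?thesis using g(2) by blast
qed

end

lemma attachment_prog_paths:
  "attachment V E x X Y m P c \<Longrightarrow> prog_paths E (X \<union> Y \<union> insert c P) x c m"
proof (induction "card P" arbitrary: P c rule: less_induct)
  case less
  interpret attachment V E x X Y m P c by (rule less.prems)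
  show ?case
  proof (cases "\<exists>S q. cut_off S q")
    case True
    then obtain S q where cut: "cut_off S q" by blast
    then have "card S < card P"
      using finite_P unfolding cut_off_def by (auto intro: psubset_card_mono)
    then show ?thesis
      using prog_paths_through_cut[OF cut less.hyps] cut_off_attachment[OF cut] by blast
  qed (rule prog_paths_if_no_cut_off)
qed

lemma attachment_shared_end:
  assumes "attachment V E x X Y m P c" "\<exists>p\<in>P. \<exists>w\<in>Y. E p w"
  shows "\<exists>g\<in>P. E g c \<and> prog_paths E (X \<union> Y \<union> P) x g m"
  using assms
proof (induction "card P" arbitrary: P rule: less_induct)
  case less
  interpret attachment V E x X Y m P c by (rule less.prems)
  consider (none) "\<nexists>S q. cut_off S q" | (at_c) S where "cut_off S c"
    | (inside) S q where "cut_off S q" "q \<noteq> c" by blast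
  then show ?case
  proof cases
    case none
    then show ?thesis using shared_end_if_no_cut_off less.prems(2) by blast
  next
    case at_c
    then have "cut_off S c" "cut_off (P - S) c" by (auto intro: cut_off_complement)
    moreover have "(\<exists>p\<in>S. \<exists>w\<in>Y. E p w) \<or> (\<exists>p\<in>P - S. \<exists>w\<in>Y. E p w)" using less.prems(2) by auto
    ultimately obtain Q where Q: "cut_off Q c" "\<exists>p\<in>Q. \<exists>w\<in>Y. E p w" by blast
    then have "Q \<subset> P" unfolding cut_off_def by blast
    then obtain g where "g \<in> Q" "E g c" "prog_paths E (X \<union> Y \<union> Q) x g m"
      using less.hyps[OF psubset_card_mono[OF finite_P] cut_off_attachment[OF Q(1)] Q(2)] by blast
    moreover from this have "prog_paths E (X \<union> Y \<union> P) x g m"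
      using \<open>Q \<subset> P\<close> by (elim prog_paths_mono) auto
    ultimately show ?thesis using \<open>Q \<subset> P\<close> by blast
  next
    case inside
    show ?thesis
      using inside attachment_prog_paths[OF cut_off_attachment[OF inside(1)]]
      by (rule shared_end_through_cut)
  qed
qed

section \<open>The path theorem for rooted graphs\<close>

locale minimal_failure = path_induction V E
  for V :: "'a set" and E :: "'a \<Rightarrow> 'a \<Rightarrow> bool" +
  fixes x y :: 'a and m :: nat
  assumes rooted: "rooted_graph V E x y m" and two_le_m: "2 \<le> m"
    and failure: "\<not> shared_end_paths V E x y m"
begin

lemma x_in_V: "x \<in> V" and y_in_V: "y \<in> V" and x_neq_y: "x \<noteq> y"
  and not_adjacent_roots: "\<not> E x y" and V_neq_roots: "V \<noteq> {x, y}"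
  and exits: "two_exits E V (V - {x, y})"
  using rooted unfolding rooted_graph_def by auto

lemma degree: "v \<in> V \<Longrightarrow> v \<noteq> x \<Longrightarrow> v \<noteq> y \<Longrightarrow> 2 * m \<le> card (nbrs V E v)"
  using rooted two_le_m unfolding rooted_graph_def by auto

lemma no_prog_paths_and_tail:
  assumes "prog_paths E A x c m" "A \<inter> B \<subseteq> {c}" "c \<noteq> y" "A \<union> B \<subseteq> V" "y \<notin> A"
  shows "\<not> joined E B c y"
  using shared_end_paths_append[OF symp_E assms(1) _ assms(2-5)] failure
  unfolding joined_def by auto

definition common :: "'a set \<Rightarrow> 'a set" where
  "common X = {v \<in> V. \<forall>u\<in>X. E u v}"

definition core :: "'a set \<Rightarrow> bool" where
  "core X \<longleftrightarrow> x \<in> X \<and> X \<subseteq> V - {y} \<and> card X \<le> card (common X)"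

definition side :: "'a set \<Rightarrow> 'a set" where
  "side X = component E (V - (X \<union> common X)) y"

definition best :: "'a set \<Rightarrow> bool" where
  "best X \<longleftrightarrow> core X \<and> (\<forall>X'. core X' \<longrightarrow>
     card X' \<le> card X \<and> (card X' = card X \<longrightarrow> card (side X') \<le> card (side X)))"

lemma common_V: "common X \<subseteq> V"
  unfolding common_def by auto

lemma common_antimono: "X \<subseteq> X' \<Longrightarrow> common X' \<subseteq> common X"
  unfolding common_def by auto

lemma common_disjoint: "X \<inter> common X = {}"
  unfolding common_def using E_irr by auto

lemma finite_common: "finite (common X)"
  using common_V finite_V by (rule finite_subset)

lemma biclique_common: "X \<subseteq> V \<Longrightarrow> Y \<subseteq> common X \<Longrightarrow> biclique E X Y"
  using common_disjoint[of X] finite_subset[OF _ finite_V, of X]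
    finite_subset[OF _ finite_common, of Y X] E_sym
  unfolding biclique_def common_def by blast

lemma side_subset: "side X \<subseteq> V - (X \<union> common X)"
  unfolding side_def by (rule component_subset)

lemma finite_side: "finite (side X)"
  using side_subset finite_V by (auto intro: finite_subset)

lemma side_step: "u \<in> side X \<Longrightarrow> t \<in> V - (X \<union> common X) \<Longrightarrow> E u t \<Longrightarrow> t \<in> side X"
  unfolding side_def by (rule component_step)

lemma
  assumes "core X"
  shows core_x: "x \<in> X" and core_V: "X \<subseteq> V" and core_y: "y \<notin> X" and core_finite: "finite X"
    and core_card: "card X \<le> card (common X)" and core_common_y: "y \<notin> common X"
    and core_common_x: "x \<notin> common X"
  using assms finite_subset[OF _ finite_V, of X] not_adjacent_roots E_irr
  unfolding core_def common_def by auto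

lemma core_side_y: "core X \<Longrightarrow> y \<in> side X"
  unfolding side_def using core_y core_common_y y_in_V by (intro component_self) auto

lemma core_common_nonempty: "core X \<Longrightarrow> common X \<noteq> {}"
  using core_x core_finite core_card card_0_eq by fastforce

lemma core_biclique: "core X \<Longrightarrow> biclique E X (common X)"
  using core_V by (intro biclique_common) auto

lemma connected_on_side: "core X \<Longrightarrow> connected_on E (side X)"
  unfolding side_def using symp_E core_y core_common_y y_in_V by (intro connected_on_component) auto

lemma best_core: "best X \<Longrightarrow> core X"
  unfolding best_def by auto

lemma ex_best: "\<exists>X. best X"
proof -
  obtain g where "g \<in> V" "E g x"
    using two_exits_nbr[of E V y x] exits V_neq_roots x_in_V y_in_V by (metis insert_commute)
  then have "g \<in> common {x}" unfolding common_def by (auto dest: E_sym)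
  then have "card (common {x}) \<noteq> 0" using finite_common by auto
  then have "core {x}" unfolding core_def using x_in_V x_neq_y by auto
  moreover have "\<forall>X. core X \<longrightarrow> card X < Suc (card V)"
    using core_V card_mono[OF finite_V] by (auto simp: less_Suc_eq_le)
  ultimately obtain X0 where X0: "core X0" "\<forall>X. core X \<longrightarrow> card X \<le> card X0"
    using ex_has_greatest_nat[of core "{x}" card] by blast
  have "card (side X) \<le> card V" for X using side_subset[of X] by (intro card_mono[OF finite_V]) auto
  then have "\<forall>X. core X \<and> card X = card X0 \<longrightarrow> card (side X) < Suc (card V)"
    by (auto simp: less_Suc_eq_le)
  then obtain X where "core X" "card X = card X0"
    "\<forall>X'. core X' \<and> card X' = card X0 \<longrightarrow> card (side X') \<le> card (side X)"
    using X0(1) ex_has_greatest_nat[of "\<lambda>X. core X \<and> card X = card X0" X0 "\<lambda>X. card (side X)"]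
    by blast
  then show ?thesis using X0(2) unfolding best_def by auto
qed

lemma best_if_side_subset:
  assumes "best X" "core X'" "card X' = card X" "side X \<subseteq> side X'"
  shows "best X'" "side X' = side X"
proof -
  have "card (side X') \<le> card (side X)" using assms unfolding best_def by auto
  then show "side X' = side X" using card_seteq[OF finite_side assms(4)] by auto
  then show "best X'" using assms unfolding best_def by auto
qed

lemma best_card_nbrs_common:
  assumes "best X" "v \<in> V" "v \<notin> X" "v \<noteq> y"
  shows "card (nbrs V E v \<inter> common X) \<le> card X"
proof (rule ccontr)
  assume large: "\<not> ?thesis"
  note core = best_core[OF assms(1)]
  have "nbrs V E v \<inter> common X \<subseteq> common (insert v X)" unfolding common_def nbrs_def by auto
  then have "card (nbrs V E v \<inter> common X) \<le> card (common (insert v X))"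
    by (intro card_mono finite_common)
  then have "core (insert v X)"
    using large core_x[OF core] core_V[OF core] core_y[OF core] core_finite[OF core] assms
    unfolding core_def by auto
  then have "card (insert v X) \<le> card X" using assms(1) unfolding best_def by auto
  then show False using core_finite[OF core] assms by auto
qed

lemma card_nbrs_less_if_not_common:
  assumes "finite X" "v \<in> V" "v \<notin> common X"
  shows "card (nbrs V E v \<inter> X) < card X"
  using assms by (intro psubset_card_mono) (auto simp: common_def nbrs_def dest: E_sym)

lemma component_attachment:
  assumes X: "x \<in> X" "X \<subseteq> V" "Y \<subseteq> common X" "card X \<le> card Y"
    and W: "W \<subseteq> V - (X \<union> common X)" "y \<notin> W" and c: "c \<in> V - (X \<union> Y \<union> W)"
    and d: "d \<in> W" "E c d"
    and out: "\<And>p t. p \<in> W \<Longrightarrow> t \<in> V \<Longrightarrow> E p t \<Longrightarrow> t \<in> insert c W \<union> X \<union> Y"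
    and bound: "\<And>p. p \<in> W \<Longrightarrow> card (nbrs V E p \<inter> Y) \<le> card X"
  shows "attachment V E x X Y m (component E (insert c W) c - {c}) c"
proof unfold_locales
  let ?C = "component E (insert c W) c"
  have sub: "?C \<subseteq> insert c W" by (rule component_subset)
  have c_self: "c \<in> ?C" by (rule component_self) simp
  show "X \<subseteq> V" "Y \<subseteq> V" "biclique E X Y" "x \<in> X" "card X \<le> card Y"
    using X common_V biclique_common by auto
  show "?C - {c} \<subseteq> V - (X \<union> Y)" "c \<in> V - (X \<union> Y \<union> (?C - {c}))" using sub W c X(3) by auto
  have "d \<in> ?C" using component_step[OF c_self _ d(2)] d(1) by auto
  then show "?C - {c} \<noteq> {}" using c d(1) by auto
  have "?C - {c} \<subseteq> V - {x, y}" using sub W X(1) by auto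
  then show "two_exits E V (?C - {c})" using exits by (rule two_exits_mono[rotated])
  show "connected_on E (insert c (?C - {c}))"
    using c_self connected_on_component[OF symp_E, of c "insert c W"] by (simp add: insert_absorb)
  fix p assume p: "p \<in> ?C - {c}"
  then have pW: "p \<in> W" using sub by auto
  show "nbrs V E p \<subseteq> insert c (?C - {c}) \<union> X \<union> Y"
    using out[OF pW] component_step[of p E "insert c W" c] p unfolding nbrs_def by blast
  show "card (nbrs V E p \<inter> X) < card X"
    using pW W X(2) finite_subset[OF _ finite_V] by (intro card_nbrs_less_if_not_common) auto
  show "card (nbrs V E p \<inter> Y) \<le> card X" using bound[OF pW] .
  show "2 * m \<le> card (nbrs V E p)" using pW W X(1) by (intro degree) auto
qed

lemma no_component_at_tail:
  assumes X: "x \<in> X" "X \<subseteq> V" "Y \<subseteq> common X" "card X \<le> card Y"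
    and W: "W \<subseteq> V - (X \<union> common X)"
    and tail: "joined E B c y" "c \<noteq> y" "B \<subseteq> V" "(X \<union> Y \<union> W) \<inter> B = {}"
    and d: "d \<in> W" "E c d"
    and out: "\<And>p t. p \<in> W \<Longrightarrow> t \<in> V \<Longrightarrow> E p t \<Longrightarrow> t \<in> insert c W \<union> X \<union> Y"
    and bound: "\<And>p. p \<in> W \<Longrightarrow> card (nbrs V E p \<inter> Y) \<le> card X"
  shows False
proof -
  have "c \<in> B" "y \<in> B" using tail(1) spath_endpoints unfolding joined_def by metis+
  then have cy: "y \<notin> X \<union> Y \<union> W" "c \<in> V - (X \<union> Y \<union> W)" using tail(3,4) by auto
  have "attachment V E x X Y m (component E (insert c W) c - {c}) c"
    by (rule component_attachment[OF X W _ _ d out bound]) (use cy in auto)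
  then have "prog_paths E (X \<union> Y \<union> insert c (component E (insert c W) c - {c})) x c m"
    by (rule attachment_prog_paths)
  then have "prog_paths E (X \<union> Y \<union> insert c W) x c m"
    by (rule prog_paths_mono) (use component_subset[of E "insert c W" c] in auto)
  moreover have "(X \<union> Y \<union> insert c W) \<inter> B \<subseteq> {c}" using tail(4) by auto
  moreover have "X \<union> Y \<union> insert c W \<union> B \<subseteq> V" using X(2,3) W tail(3) cy common_V[of X] by auto
  moreover have "y \<notin> X \<union> Y \<union> insert c W" using cy(1) tail(2) by auto
  ultimately show False using no_prog_paths_and_tail[OF _ _ tail(2)] tail(1) by metis
qed

lemma best_no_edge_side_common:
  assumes "best X" "u \<in> side X" "u \<noteq> y" "t \<in> common X"
  shows "\<not> E u t"
proof
  assume ut: "E u t"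
  note core = best_core[OF assms(1)]
  let ?W = "V - (X \<union> common X) - {y}"
  have W: "insert y ?W = V - (X \<union> common X)"
    using core_y[OF core] core_common_y[OF core] y_in_V by auto
  have "{y} \<subset> side X" using assms(2,3) core_side_y[OF core] by auto
  then obtain d where d: "d \<in> side X" "d \<noteq> y" "E y d"
    using connected_on_boundary[OF connected_on_side[OF core]] unfolding boundary_def by blast
  have "attachment V E x X (common X) m (component E (insert y ?W) y - {y}) y"
  proof (rule component_attachment[OF core_x[OF core] core_V[OF core] subset_refl
        core_card[OF core]])
    show "d \<in> ?W" using d side_subset by auto
  qed (use y_in_V core_y[OF core] core_common_y[OF core] d(3) best_card_nbrs_common[OF assms(1)]
      in auto)
  then have attachment: "attachment V E x X (common X) m (side X - {y}) y" unfolding W side_def .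
  have "\<exists>p\<in>side X - {y}. \<exists>w\<in>common X. E p w" using assms(2-4) ut by auto
  from attachment_shared_end[OF attachment this] obtain g where g: "g \<in> side X - {y}" "E g y"
    "prog_paths E (X \<union> common X \<union> (side X - {y})) x g m" by auto
  have "prog_paths E (V - {y}) x g m"
    using g(3) by (rule prog_paths_mono)
      (use core_V[OF core] core_y[OF core] core_common_y[OF core] common_V side_subset[of X]
        in auto)
  then show False using failure g side_subset[of X] unfolding shared_end_paths_def by auto
qed

lemma best_edge_side_core:
  assumes "best X" "side X \<noteq> {y}"
  shows "\<exists>e\<in>X - {x}. \<exists>u\<in>side X - {y}. E e u"
proof (rule ccontr)
  assume no_edge: "\<not> ?thesis"
  note core = best_core[OF assms(1)]
  let ?V = "insert x (side X)"
  have V: "?V - {x, y} = side X - {y}" "?V \<subseteq> V" "x \<notin> side X"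
    using side_subset[of X] core_x[OF core] x_in_V by auto
  have out: "t \<in> ?V" if "u \<in> side X - {y}" "t \<in> V" "E u t" for u t
    using that side_step[of u X t] best_no_edge_side_common[OF assms(1), of u t] no_edge E_sym
    by blast
  have "two_exits E V (side X - {y})" using exits by (rule two_exits_mono) (use V in auto)
  then have "two_exits E ?V (side X - {y})" by (rule two_exits_transfer) (use out in blast)
  moreover have "2 * m \<le> card (nbrs ?V E v)" if v: "v \<in> side X - {y}" for v
  proof -
    have "nbrs ?V E v = nbrs V E v" using out[OF v] V(2) unfolding nbrs_def by auto
    then show ?thesis using degree[of v] v V(2,3) by auto
  qed
  moreover have "?V \<noteq> {x, y}" using assms(2) core_side_y[OF core] V(3) by auto
  ultimately have smaller_rooted: "rooted_graph ?V E x y m"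
    unfolding rooted_graph_def V(1)
    using finite_side core_side_y[OF core] x_neq_y symp_E irreflp_E not_adjacent_roots by auto
  have "card ?V < card V"
  proof (rule psubset_card_mono[OF finite_V])
    obtain b where "b \<in> common X" using core_common_nonempty[OF core] by auto
    then have "b \<in> V" "b \<notin> ?V" using common_V side_subset[of X] core_common_x[OF core] by auto
    then show "?V \<subset> V" using V(2) by auto
  qed
  from smaller[OF this smaller_rooted] obtain g
    where g: "g \<in> ?V - {y}" "E g y" "prog_paths E (?V - {y}) x g m"
    unfolding shared_end_paths_def by auto
  have "prog_paths E (V - {y}) x g m" using g(3) by (rule prog_paths_mono) (use V(2) in auto)
  then show False using failure g V(2) unfolding shared_end_paths_def by blast
qed

lemma card_less_if_common_nbr:
  assumes "core X" "e \<in> common X" "E e y"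
  shows "card X < m"
proof (rule ccontr)
  assume large: "\<not> card X < m"
  have "prog_paths E (X \<union> common X) x e (card X)"
    using biclique_prog_across[OF core_biclique core_x _ core_card] assms by auto
  then have "prog_paths E (X \<union> common X) x e m" by (rule prog_paths_mono) (use large in auto)
  moreover have "e \<noteq> y" using assms core_common_y by auto
  moreover have "joined E {e, y} e y" using assms(3) by (rule joined_edge) auto
  moreover have "(X \<union> common X) \<inter> {e, y} \<subseteq> {e}" "y \<notin> X \<union> common X"
    using assms(1) core_y core_common_y by auto
  moreover have "X \<union> common X \<union> {e, y} \<subseteq> V"
    using assms core_V[OF assms(1)] common_V[of X] y_in_V by auto
  ultimately show False using no_prog_paths_and_tail by metis
qed

lemma best_card_common_le:
  assumes "best X" "side X = {y}" "e \<in> common X" "E e y"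
  shows "card (common X) \<le> card X"
proof (rule ccontr)
  assume large: "\<not> ?thesis"
  note core = best_core[OF assms(1)]
  have e: "e \<in> V" "e \<noteq> y" "e \<noteq> x" "e \<notin> X"
    using assms core_common_x[OF core] core_common_y[OF core] common_disjoint[of X] common_V by auto
  let ?W = "V - (X \<union> common X \<union> {y})"
  have "card X + card (nbrs V E e \<inter> common X) + card {y} < card (nbrs V E e)"
    using best_card_nbrs_common[OF assms(1) e(1,4,2)] degree[OF e(1,3,2)]
      card_less_if_common_nbr[OF core assms(3,4)]
    by simp
  from ex_nbr_outside[OF core_finite[OF core] _ this] obtain d where d: "d \<in> ?W" "E e d" by auto
  show False
  proof (rule no_component_at_tail[OF core_x[OF core] core_V[OF core] _ _ _ _ e(2) _ _ d])
    show "joined E {e, y} e y" using assms(4) by (rule joined_edge) auto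
    show "common X - {e} \<subseteq> common X" "?W \<subseteq> V - (X \<union> common X)" "{e, y} \<subseteq> V" using e y_in_V by auto
    show "card X \<le> card (common X - {e})" using large assms(3) finite_common by auto
    show "(X \<union> (common X - {e}) \<union> ?W) \<inter> {e, y} = {}"
      using e assms(3) core_y[OF core] core_common_y[OF core] by auto
    fix p assume p: "p \<in> ?W"
    show "t \<in> insert e ?W \<union> X \<union> (common X - {e})" if t: "t \<in> V" "E p t" for t
    proof -
      have "t \<noteq> y" using p t assms(2) side_step[of y X p] E_sym by auto
      then show ?thesis using t(1) by auto
    qed
    have "card (nbrs V E p \<inter> common X) \<le> card X" using best_card_nbrs_common[OF assms(1)] p by auto
    then show "card (nbrs V E p \<inter> (common X - {e})) \<le> card X"
      by (rule card_nbrs_Int_mono[OF finite_common]) auto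
  qed
qed

end

text \<open>A vertex \<open>u\<close> is removed from \<open>X\<close>, and \<open>e\<close>, possibly \<open>u\<close> itself, serves as the way out to \<open>y\<close>.
  If the smaller biclique violated the degree bound, replacing \<open>u\<close> by the violating vertex would
  give another best set with the same side, which the adjacency of \<open>e\<close> to this side rules out.\<close>

locale exit_vertex = minimal_failure V E x y m
  for V :: "'a set" and E :: "'a \<Rightarrow> 'a \<Rightarrow> bool" and x y :: 'a and m :: nat +
  fixes X :: "'a set" and u e :: 'a
  assumes best_X: "best X" and u_in: "u \<in> X - {x}" and e_in: "e \<in> V - (X - {u}) - side X"
    and exit: "\<exists>w\<in>side X. E e w \<and> (w = y \<longrightarrow> side X = {y})"
    and only_exit: "u = e \<or> (\<forall>w\<in>side X. \<not> E u w)"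
begin

definition reduced_core :: "'a set" where
  "reduced_core = X - {u}"

definition reduced_common :: "'a set" where
  "reduced_common = common reduced_core - insert e (side X)"

definition remainder :: "'a set" where
  "remainder = V - (reduced_core \<union> reduced_common \<union> insert e (side X))"

lemma core_X: "core X"
  using best_X by (rule best_core)

lemma card_X: "card X = Suc (card reduced_core)"
  unfolding reduced_core_def using card.remove[OF core_finite[OF core_X], of u] u_in by auto

lemma reduced_core: "x \<in> reduced_core" "reduced_core \<subseteq> V" "finite reduced_core" "y \<notin> reduced_core"
    "side X \<inter> reduced_core = {}" "e \<notin> reduced_core"
  using core_x[OF core_X] core_V[OF core_X] core_finite[OF core_X] core_y[OF core_X] u_in e_in
    side_subset[of X]
  unfolding reduced_core_def by auto

lemma e_neq: "e \<noteq> x" "e \<noteq> y"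
  using reduced_core core_side_y[OF core_X] e_in by auto

lemma common_subset_reduced_common: "common X - {e} \<subseteq> reduced_common"
  using common_antimono[of reduced_core X] side_subset[of X]
  unfolding reduced_common_def reduced_core_def by auto

lemma finite_reduced_common: "finite reduced_common"
  using finite_common unfolding reduced_common_def by auto

lemma remainder_subset: "remainder \<subseteq> V - (reduced_core \<union> common reduced_core)"
  unfolding remainder_def reduced_common_def by auto

lemma exit_joined: "joined E (insert e (side X)) e y"
proof -
  obtain w where w: "w \<in> side X" "E e w" using exit by auto
  then have "joined E (side X) w y"
    using connected_on_side[OF core_X] core_side_y[OF core_X] unfolding connected_on_def by auto
  then have "joined E (insert e (side X)) w y" by (rule joined_mono) auto
  moreover have "joined E (insert e (side X)) e w" using w by (intro joined_edge) auto
  ultimately show ?thesis by (rule joined_trans[rotated])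
qed

lemma best_replacement:
  assumes v: "v \<in> V - (reduced_core \<union> side X)"
    and large: "card reduced_core < card (nbrs V E v \<inter> reduced_common)"
  shows "best (insert v reduced_core)" "side (insert v reduced_core) = side X"
    "card (insert v reduced_core) \<le> card (common (insert v reduced_core) - {e})"
proof -
  let ?X = "insert v reduced_core"
  have card: "card ?X = card X" using v reduced_core(3) card_X by auto
  have "nbrs V E v \<inter> reduced_common \<subseteq> common ?X - {e}"
    unfolding reduced_common_def common_def nbrs_def by auto
  then show le: "card ?X \<le> card (common ?X - {e})"
    using card_mono[OF finite_Diff[OF finite_common]] large card card_X
    by (metis Suc_leI le_trans)
  then have "card ?X \<le> card (common ?X)"
    using card_mono[OF finite_common, of "common ?X - {e}" ?X] by auto
  moreover have "v \<noteq> y" using v core_side_y[OF core_X] by auto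
  ultimately have core: "core ?X" using reduced_core v unfolding core_def by auto
  have "side X \<inter> common ?X = {}"
  proof (rule ccontr)
    assume "side X \<inter> common ?X \<noteq> {}"
    then obtain t where t: "t \<in> side X" "t \<in> common ?X" by auto
    have "t \<noteq> y" "E t v" using t(2) core_common_y[OF core] E_sym unfolding common_def by auto
    then have "v \<notin> common X" using best_no_edge_side_common[OF best_X t(1)] by auto
    then have "v \<in> X" using side_step[OF t(1) _ \<open>E t v\<close>] v by auto
    then have "?X = X" using v u_in unfolding reduced_core_def by auto
    then show False using t side_subset[of X] by auto
  qed
  then have "side X \<subseteq> V - (?X \<union> common ?X)" using side_subset[of X] reduced_core(5) v by auto
  then have "side X \<subseteq> side ?X"
    using connected_on_subset_component[OF connected_on_side[OF core_X] core_side_y[OF core_X]]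
    unfolding side_def[of ?X] by blast
  then show "best ?X" "side ?X = side X" using best_if_side_subset[OF best_X core card] by auto
qed

lemma card_nbrs_reduced_common:
  assumes v: "v \<in> V - (reduced_core \<union> side X)" "v \<noteq> e"
  shows "card (nbrs V E v \<inter> reduced_common) \<le> card reduced_core"
proof (rule ccontr)
  assume "\<not> ?thesis"
  then have large: "card reduced_core < card (nbrs V E v \<inter> reduced_common)" by simp
  let ?X = "insert v reduced_core"
  note new = best_replacement[OF v(1) large]
  obtain w where w: "w \<in> side X" "E e w" "w = y \<longrightarrow> side X = {y}" using exit by auto
  show False
  proof (cases "e \<in> common ?X")
    case in_common: True
    have "w = y"
      using best_no_edge_side_common[OF new(1) _ _ in_common, of w] new(2) w(1,2) E_sym by auto
    then have "card (common ?X) \<le> card ?X"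
      using best_card_common_le[OF new(1) _ in_common] new(2) w by auto
    moreover have "card (common ?X) = Suc (card (common ?X - {e}))"
      by (rule card.remove[OF finite_common in_common])
    ultimately show False using new(3) by linarith
  next
    case False
    then have "e \<in> side ?X"
      using side_step[of w ?X e] new(2) w(1,2) v(2) reduced_core(6) e_in E_sym by auto
    then show False using new(2) e_in by auto
  qed
qed

lemma remainder_closed:
  assumes "p \<in> remainder" "t \<in> V" "E p t"
  shows "t \<in> insert e remainder \<union> reduced_core \<union> reduced_common"
proof -
  have p: "p \<in> V" "p \<notin> reduced_core" "p \<notin> reduced_common" "p \<notin> side X" "p \<noteq> e"
    using assms(1) unfolding remainder_def by auto
  have "t \<notin> side X"
  proof
    assume t: "t \<in> side X"
    have "p \<notin> common X" using p common_subset_reduced_common by auto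
    then have "p \<in> X" using side_step[OF t _ E_sym[OF assms(3)]] p(1,4) by auto
    then have "p = u" using p(2) unfolding reduced_core_def by auto
    then show False using only_exit p(5) t assms(3) by auto
  qed
  then show ?thesis using assms(2) unfolding remainder_def by auto
qed

lemma remainder_bound:
  "p \<in> remainder \<Longrightarrow> card (nbrs V E p \<inter> reduced_common) \<le> card reduced_core"
  unfolding remainder_def by (intro card_nbrs_reduced_common) auto

lemma card_reduced_common: "card reduced_core \<le> card reduced_common"
proof -
  have "card (common X) - 1 \<le> card (common X - {e})"
    using finite_common by (simp add: card_Diff_singleton_if)
  also have "\<dots> \<le> card reduced_common"
    using finite_reduced_common common_subset_reduced_common by (rule card_mono)
  finally show ?thesis using core_card[OF core_X] card_X by linarith
qed

lemma exit_no_nbr_remainder: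
  assumes "d \<in> remainder"
  shows "\<not> E e d"
proof
  assume ed: "E e d"
  show False
  proof (rule no_component_at_tail[OF reduced_core(1,2) _ card_reduced_common remainder_subset
        exit_joined e_neq(2) _ _ assms ed])
    show "reduced_common \<subseteq> common reduced_core" unfolding reduced_common_def by auto
    show "insert e (side X) \<subseteq> V" using e_in side_subset by auto
    show "(reduced_core \<union> reduced_common \<union> remainder) \<inter> insert e (side X) = {}"
      using reduced_core(5,6) unfolding reduced_common_def remainder_def by auto
  qed (use remainder_closed remainder_bound in auto)
qed

lemma card_le_if_exit_in_core:
  assumes "u = e"
  shows "card X \<le> m"
proof (rule ccontr)
  assume large: "\<not> card X \<le> m"
  have "prog_paths E (X \<union> common X) x e (card X - 1)"
    using u_in assms biclique_prog_within[OF core_biclique core_x _ _ core_card] core_X by auto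
  then have "prog_paths E (X \<union> common X) x e m" by (rule prog_paths_mono) (use large in auto)
  moreover have "(X \<union> common X) \<inter> insert e (side X) \<subseteq> {e}" using side_subset[of X] by auto
  moreover have "X \<union> common X \<union> insert e (side X) \<subseteq> V"
    using e_in side_subset[of X] core_V[OF core_X] common_V[of X] by auto
  moreover have "y \<notin> X \<union> common X" using core_X core_y core_common_y by auto
  ultimately show False using no_prog_paths_and_tail[OF _ _ e_neq(2)] exit_joined by metis
qed

lemma common_nbr_remainder:
  assumes "u = e" "b \<in> common X"
  shows "\<exists>d\<in>remainder. E b d"
proof -
  have b: "b \<in> V" "b \<noteq> x" "b \<noteq> y" "b \<notin> X" "b \<notin> side X"
    using assms(2) core_common_x[OF core_X] core_common_y[OF core_X] common_V[of X]
      common_disjoint[of X] side_subset[of X] by auto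
  have "b \<in> V - (reduced_core \<union> side X)" "b \<noteq> e" using b u_in assms(1) reduced_core_def by auto
  then have "card (nbrs V E b \<inter> reduced_common) \<le> card reduced_core"
    by (rule card_nbrs_reduced_common)
  moreover have "card X + card reduced_core + of_bool (E b y) < 2 * m"
    using card_X card_le_if_exit_in_core[OF assms(1)] card_less_if_common_nbr[OF core_X assms(2)]
    by (cases "E b y") auto
  moreover have "card {t. t = y \<and> E b y} = of_bool (E b y)" by (cases "E b y") auto
  ultimately have
    "card X + card (nbrs V E b \<inter> reduced_common) + card {t. t = y \<and> E b y} < card (nbrs V E b)"
    using degree[OF b(1-3)] by linarith
  from ex_nbr_outside[OF core_finite[OF core_X] _ this] obtain d
    where d: "d \<in> V" "d \<notin> X" "d \<notin> reduced_common" "d \<noteq> y" "E b d" by auto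
  from d(4) have "d \<notin> side X"
    using best_no_edge_side_common[OF best_X _ _ assms(2)] E_sym[OF d(5)] by auto
  then have "d \<in> remainder"
    using d(1-3) u_in assms(1) unfolding remainder_def reduced_core_def by auto
  then show ?thesis using d(5) by auto
qed

lemma exit_not_in_core: "u \<noteq> e"
proof
  assume ue: "u = e"
  obtain b where b: "b \<in> common X" using core_common_nonempty[OF core_X] by auto
  then have b': "b \<in> V" "b \<noteq> y" "b \<notin> X" "b \<notin> side X" "E b e"
    using core_common_y[OF core_X] common_V[of X] common_disjoint[of X] side_subset[of X] u_in ue
      E_sym
    unfolding common_def by auto
  obtain d where d: "d \<in> remainder" "E b d" using common_nbr_remainder[OF ue b] by auto
  let ?B = "insert b (insert e (side X))"
  have "joined E ?B e y" using exit_joined by (rule joined_mono) auto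
  moreover have "joined E ?B b e" using b'(5) by (rule joined_edge) auto
  ultimately have tail: "joined E ?B b y" by (rule joined_trans[rotated])
  show False
  proof (rule no_component_at_tail[OF reduced_core(1,2) _ _ remainder_subset tail b'(2) _ _ d])
    show "reduced_common - {b} \<subseteq> common reduced_core" unfolding reduced_common_def by auto
    have "e \<notin> common X" using u_in ue common_disjoint[of X] by auto
    then have common: "common X \<subseteq> reduced_common" using common_subset_reduced_common by auto
    then have "card X \<le> card reduced_common"
      using core_card[OF core_X] card_mono[OF finite_reduced_common] by (meson le_trans)
    then show "card reduced_core \<le> card (reduced_common - {b})"
      using card_X b common finite_reduced_common by auto
    show "?B \<subseteq> V" using b'(1) e_in side_subset by auto
    show "(reduced_core \<union> (reduced_common - {b}) \<union> remainder) \<inter> ?B = {}"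
      using reduced_core(5,6) b b'(3) common
      unfolding reduced_common_def remainder_def reduced_core_def by auto
    fix p assume p: "p \<in> remainder"
    show "t \<in> insert b remainder \<union> reduced_core \<union> (reduced_common - {b})" if "t \<in> V" "E p t" for t
      using remainder_closed[OF p that] exit_no_nbr_remainder[OF p] that(2) E_sym by auto
    show "card (nbrs V E p \<inter> (reduced_common - {b})) \<le> card reduced_core"
      using finite_reduced_common remainder_bound[OF p] by (rule card_nbrs_Int_mono) auto
  qed
qed

lemma card_nbrs_exit: "card (nbrs V E e \<inter> reduced_common) \<le> card reduced_core"
proof (rule ccontr)
  assume "\<not> ?thesis"
  moreover have "e \<in> V - (reduced_core \<union> side X)" using e_in reduced_core(6) by auto
  ultimately have "best (insert e reduced_core)" "side (insert e reduced_core) = side X"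
    using best_replacement[of e] by auto
  then interpret new: exit_vertex V E x y m "insert e reduced_core" e e
    using e_in e_neq(1) exit by unfold_locales (auto simp: reduced_core_def)
  show False using new.exit_not_in_core by simp
qed

lemma exit_not_common:
  assumes "side X = {y}" "E e y"
  shows "e \<notin> common X"
proof
  assume "e \<in> common X"
  then have "card X < m" using card_less_if_common_nbr[OF core_X _ assms(2)] by auto
  then have "card reduced_core + card (nbrs V E e \<inter> reduced_common) + card {y} < card (nbrs V E e)"
    using card_nbrs_exit degree[of e] e_in e_neq card_X by auto
  from ex_nbr_outside[OF reduced_core(3) _ this] obtain d
    where "d \<in> V - (reduced_core \<union> reduced_common \<union> {y})" "E e d" by auto
  then have "d \<in> remainder" using assms(1) E_irr unfolding remainder_def by auto
  then show False using exit_no_nbr_remainder \<open>E e d\<close> by auto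
qed

end

context minimal_failure
begin

lemma best_no_core_exit:
  assumes "best X" "e \<in> X - {x}" "w \<in> side X" "w = y \<longrightarrow> side X = {y}"
  shows "\<not> E e w"
proof
  assume "E e w"
  then interpret exit_vertex V E x y m X e e
    using assms core_V[OF best_core[OF assms(1)]] side_subset[of X] by unfold_locales auto
  show False using exit_not_in_core by simp
qed

lemma best_side: "best X \<Longrightarrow> side X = {y}"
  using best_edge_side_core best_no_core_exit by blast

lemma best_nbrs_y:
  assumes "best X" "E t y" "t \<in> V"
  shows "t \<in> common X"
proof (rule ccontr)
  assume t: "t \<notin> common X"
  have "t \<noteq> y" "t \<noteq> x" using assms(2) E_irr not_adjacent_roots by auto
  moreover have "t \<notin> X"
    using best_no_core_exit[OF assms(1), of t y] best_side[OF assms(1)] assms(2) \<open>t \<noteq> x\<close> by auto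
  ultimately show False
    using side_step[of y X t] best_side[OF assms(1)] assms(2,3) t E_sym by auto
qed

lemma best_not_singleton:
  assumes "best X"
  shows "X \<noteq> {x}"
proof
  assume X: "X = {x}"
  obtain e where e: "e \<in> V" "e \<noteq> x" "e \<noteq> y" "E e y"
    using two_exits_nbr[OF exits V_neq_roots x_in_V y_in_V] .
  have "e \<in> common X" using best_nbrs_y[OF assms e(4,1)] .
  moreover from this have "card (common X) \<le> 1"
    using best_card_common_le[OF assms best_side[OF assms] _ e(4)] X by auto
  ultimately have common: "common X = {e}"
    using card_le_Suc0_iff_eq[OF finite_common] by auto
  have "card {x, y, e} < card (nbrs V E e)"
    using degree[OF e(1-3)] two_le_m card_length[of "[x, y, e]"] by simp
  then obtain d where d: "d \<in> V - {x, y, e}"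
    using ex_nbr_outside[of "{x, y, e}" "{}" V E e "{}"] by auto
  have "boundary E V (V - {x, y, e}) \<subseteq> {e}"
  proof
    fix t assume "t \<in> boundary E V (V - {x, y, e})"
    then obtain u where u: "u \<in> V" "u \<noteq> e" "t \<in> {x, y, e}" "E u t"
      unfolding boundary_def by auto
    have "t \<noteq> y" using best_nbrs_y[OF assms _ u(1)] u(2,4) common by auto
    moreover have "t \<noteq> x" using u common X E_sym unfolding common_def by blast
    ultimately show "t \<in> {e}" using u(3) by auto
  qed
  moreover have "V - {x, y, e} \<subseteq> V - {x, y}" "V - {x, y, e} \<noteq> {}" using d by auto
  ultimately show False using two_exitsD[OF exits] by blast
qed

lemma contradiction: False
proof -
  obtain X where best: "best X" using ex_best by auto
  obtain e where e: "e \<in> V" "e \<noteq> y" "E e y"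
    using two_exits_nbr[OF exits V_neq_roots x_in_V y_in_V] by metis
  have common: "e \<in> common X" using best_nbrs_y[OF best e(3,1)] .
  obtain u where u: "u \<in> X - {x}"
    using best_not_singleton[OF best] core_x[OF best_core[OF best]] by auto
  interpret exit_vertex V E x y m X u e
  proof unfold_locales
    show "e \<in> V - (X - {u}) - side X"
      using e common common_disjoint[of X] best_side[OF best] by auto
    show "u = e \<or> (\<forall>w\<in>side X. \<not> E u w)"
      using best_no_core_exit[OF best u] best_side[OF best] by auto
  qed (use best u e best_side[OF best] in auto)
  show False using exit_not_common[OF best_side[OF best] e(3)] common by simp
qed

end

theorem rooted_graph_shared_end_paths:
  "rooted_graph V E x y m \<Longrightarrow> shared_end_paths V E x y m"
proof (induction "card V" arbitrary: V E x y m rule: less_induct)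
  case less
  show ?case
  proof (cases "m \<le> 1")
    case False
    show ?thesis
    proof (rule ccontr)
      assume "\<not> ?thesis"
      then interpret minimal_failure V E x y m
        using less False by unfold_locales (auto simp: rooted_graph_def)
      show False by (rule contradiction)
    qed
  qed (rule shared_end_paths_le_one[OF less.prems])
qed

section \<open>Parities of paths in rooted graphs\<close>

definition two_colouring :: "('a \<Rightarrow> 'a \<Rightarrow> bool) \<Rightarrow> 'a set \<Rightarrow> ('a \<Rightarrow> bool) \<Rightarrow> bool" where
  "two_colouring E V col \<longleftrightarrow> (\<forall>u\<in>V. \<forall>v\<in>V. E u v \<longrightarrow> col u \<noteq> col v)"

lemma spath_parity:
  assumes "spath E A u v n" "two_colouring E A col"
  shows "odd n \<longleftrightarrow> col u \<noteq> col v"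
  using assms
proof (induction rule: spath.induct)
  case (step u A v w n)
  have "v \<in> A" using spath_endpoints(1)[OF step.hyps(3)] by auto
  then have "col u \<noteq> col v" using step.hyps(1,2) step.prems unfolding two_colouring_def by auto
  moreover have "two_colouring E (A - {u}) col" using step.prems unfolding two_colouring_def by auto
  ultimately show ?case using step.IH by auto
qed simp

lemma two_colouring_glue:
  assumes "two_colouring E A colA" "two_colouring E B colB"
    and "\<And>t. t \<in> A \<Longrightarrow> t \<in> B \<Longrightarrow> colA t = colB t"
    and "\<And>s t. s \<in> A \<union> B \<Longrightarrow> t \<in> A \<union> B \<Longrightarrow> E s t \<Longrightarrow> s \<in> A \<and> t \<in> A \<or> s \<in> B \<and> t \<in> B"
  shows "two_colouring E (A \<union> B) (\<lambda>t. if t \<in> A then colA t else colB t)"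
  unfolding two_colouring_def
proof (intro ballI impI)
  let ?col = "\<lambda>t. if t \<in> A then colA t else colB t"
  fix s t assume st: "s \<in> A \<union> B" "t \<in> A \<union> B" "E s t"
  have col_B: "?col r = colB r" if "r \<in> B" for r using assms(3) that by simp
  from assms(4)[OF st] show "?col s \<noteq> ?col t"
  proof (elim disjE conjE)
    assume "s \<in> A" "t \<in> A"
    then show ?thesis using assms(1) st(3) unfolding two_colouring_def by simp
  next
    assume B: "s \<in> B" "t \<in> B"
    then have "colB s \<noteq> colB t" using assms(2) st(3) unfolding two_colouring_def by simp
    then show ?thesis unfolding col_B[OF B(1)] col_B[OF B(2)] .
  qed
qed

text \<open>Here \<open>N u c\<close> means that a path with parity \<open>c\<close> from a vertex outside \<open>V\<close> may
  continue at \<open>u\<close>. Moving a vertex from \<open>V\<close> to the outside then plays the role of a contraction,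
  and the labels keep track of the parities.\<close>

definition entry_parity ::
  "('a \<Rightarrow> 'a \<Rightarrow> bool) \<Rightarrow> 'a set \<Rightarrow> ('a \<Rightarrow> bool \<Rightarrow> bool) \<Rightarrow> 'a \<Rightarrow> bool \<Rightarrow> bool" where
  "entry_parity E V N y b \<longleftrightarrow> (\<exists>u c n. N u c \<and> spath E V u y n \<and> (b \<longleftrightarrow> c \<noteq> odd n))"

definition entered ::
  "('a \<Rightarrow> 'a \<Rightarrow> bool) \<Rightarrow> 'a set \<Rightarrow> ('a \<Rightarrow> bool \<Rightarrow> bool) \<Rightarrow> 'a \<Rightarrow> bool" where
  "entered E V N y \<longleftrightarrow> y \<in> V \<and> connected_on E V \<and>
     (\<forall>S \<subseteq> V - {y}. S \<noteq> {} \<longrightarrow> (\<exists>u\<in>S. \<exists>c. N u c) \<or> (\<forall>q. \<not> boundary E V S \<subseteq> {q}))"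

definition entry_colouring ::
  "('a \<Rightarrow> 'a \<Rightarrow> bool) \<Rightarrow> 'a set \<Rightarrow> ('a \<Rightarrow> bool \<Rightarrow> bool) \<Rightarrow> ('a \<Rightarrow> bool) \<Rightarrow> bool" where
  "entry_colouring E V N col \<longleftrightarrow> two_colouring E V col \<and> (\<forall>u\<in>V. \<forall>c. N u c \<longrightarrow> c = col u)"

definition colouring_or_parities ::
  "('a \<Rightarrow> 'a \<Rightarrow> bool) \<Rightarrow> 'a set \<Rightarrow> ('a \<Rightarrow> bool \<Rightarrow> bool) \<Rightarrow> 'a \<Rightarrow> bool" where
  "colouring_or_parities E V N y \<longleftrightarrow>
     (\<exists>col. entry_colouring E V N col) \<or> (\<forall>b. entry_parity E V N y b)"

lemma entry_parity_append:
  assumes "entry_parity E A N v b" "spath E B v y n" "A \<inter> B \<subseteq> {v}"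
  shows "entry_parity E (A \<union> B) N y (b \<noteq> odd n)"
proof -
  obtain u c k where "N u c" "spath E A u v k" "b \<longleftrightarrow> c \<noteq> odd k"
    using assms(1) unfolding entry_parity_def by blast
  moreover from this(2) have "spath E (A \<union> B) u y (k + n)" using assms(2,3) by (rule spath_append)
  ultimately show ?thesis
    unfolding entry_parity_def by (intro exI[of _ u] exI[of _ c] exI[of _ "k + n"]) auto
qed

lemma entry_parity_mono: "entry_parity E A N y b \<Longrightarrow> A \<subseteq> B \<Longrightarrow> entry_parity E B N y b"
  unfolding entry_parity_def using spath_mono by metis

lemma enteredD:
  "entered E V N y \<Longrightarrow> S \<subseteq> V - {y} \<Longrightarrow> S \<noteq> {} \<Longrightarrow>
    (\<exists>u\<in>S. \<exists>c. N u c) \<or> (\<forall>q. \<not> boundary E V S \<subseteq> {q})"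
  unfolding entered_def by simp

lemma entered_joined: "entered E V N y \<Longrightarrow> v \<in> V \<Longrightarrow> joined E V v y"
  unfolding entered_def connected_on_def by auto

lemma entered_entry:
  assumes "entered E V N y" "V \<noteq> {y}"
  obtains v b where "v \<in> V - {y}" "N v b"
proof -
  have "boundary E V (V - {y}) \<subseteq> {y}" "V - {y} \<noteq> {}"
    using assms unfolding entered_def boundary_def by auto
  then show ?thesis using assms(1) that unfolding entered_def by blast
qed

lemma colouring_or_parities_singleton:
  assumes "irreflp E"
  shows "colouring_or_parities E {y} N y"
proof (cases "N y True \<and> N y False")
  case True
  have "spath E {y} y y 0" by (rule spath.refl) simp
  moreover have "N y b" for b using True by (cases b) auto
  ultimately have "entry_parity E {y} N y b" for b
    unfolding entry_parity_def by (intro exI[of _ y] exI[of _ b] exI[of _ 0]) simp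
  then show ?thesis unfolding colouring_or_parities_def by blast
next
  case False
  then have "entry_colouring E {y} N (\<lambda>_. N y True)"
    using assms unfolding entry_colouring_def two_colouring_def
    by (auto dest: irreflpD) (metis (full_types))+
  then show ?thesis unfolding colouring_or_parities_def by blast
qed

definition moved_entries ::
  "('a \<Rightarrow> 'a \<Rightarrow> bool) \<Rightarrow> ('a \<Rightarrow> bool \<Rightarrow> bool) \<Rightarrow> 'a \<Rightarrow> bool \<Rightarrow> 'a \<Rightarrow> bool \<Rightarrow> bool" where
  "moved_entries E N v b u c \<longleftrightarrow> N u c \<or> E v u \<and> c \<noteq> b"

lemma entered_moved:
  assumes "entered E V N y" "symp E" "v \<noteq> y" "connected_on E (V - {v})"
  shows "entered E (V - {v}) (moved_entries E N v b) y"
  unfolding entered_def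
proof (intro conjI allI impI)
  fix S assume S: "S \<subseteq> V - {v} - {y}" "S \<noteq> {}"
  show "(\<exists>u\<in>S. \<exists>c. moved_entries E N v b u c) \<or> (\<forall>q. \<not> boundary E (V - {v}) S \<subseteq> {q})"
  proof (cases "v \<in> boundary E V S")
    case True
    then obtain u where "u \<in> S" "E v u" using assms(2) unfolding boundary_def by (auto dest: sympD)
    then have "moved_entries E N v b u (\<not> b)" unfolding moved_entries_def by auto
    then show ?thesis using \<open>u \<in> S\<close> by blast
  next
    case False
    then have "boundary E (V - {v}) S = boundary E V S" by (simp add: boundary_Diff)
    moreover have "S \<subseteq> V - {y}" using S(1) by auto
    ultimately have "(\<exists>u\<in>S. \<exists>c. N u c) \<or> (\<forall>q. \<not> boundary E (V - {v}) S \<subseteq> {q})"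
      using enteredD[OF assms(1) _ S(2)] by simp
    then show ?thesis unfolding moved_entries_def by blast
  qed
qed (use assms in \<open>auto simp: entered_def\<close>)

lemma entry_parity_moved:
  assumes "entry_parity E (V - {v}) (moved_entries E N v b) y p" "v \<in> V" "N v b"
  shows "entry_parity E V N y p"
proof -
  obtain u c n where u: "moved_entries E N v b u c" "spath E (V - {v}) u y n" "p \<longleftrightarrow> c \<noteq> odd n"
    using assms(1) unfolding entry_parity_def by blast
  consider "N u c" | "E v u" "c \<noteq> b" using u(1) unfolding moved_entries_def by auto
  then show ?thesis
  proof cases
    case 1
    have "spath E V u y n" using u(2) by (rule spath_mono) auto
    then show ?thesis using 1 u(3) unfolding entry_parity_def by blast
  next
    case 2
    have "spath E V v y (Suc n)" using assms(2) 2(1) u(2) by (rule spath.step)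
    moreover have "p \<longleftrightarrow> b \<noteq> odd (Suc n)" using u(3) 2(2) by auto
    ultimately show ?thesis using assms(3) unfolding entry_parity_def by blast
  qed
qed

lemma entry_colouring_moved:
  assumes "entry_colouring E (V - {v}) (moved_entries E N v b) col" "symp E" "irreflp E"
    and "\<And>c. N v c \<Longrightarrow> c = b"
  shows "entry_colouring E V N (col(v := b))"
proof -
  have nbr: "col u \<noteq> b" if "u \<in> V" "u \<noteq> v" "E v u" for u
    using that assms(1) unfolding entry_colouring_def moved_entries_def by auto
  have "two_colouring E V (col(v := b))"
    unfolding two_colouring_def
  proof (intro ballI impI)
    fix s t assume st: "s \<in> V" "t \<in> V" "E s t"
    then have "E t s" "s \<noteq> t" using sympD[OF assms(2)] irreflpD[OF assms(3)] by metis+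
    moreover have "col s \<noteq> col t" if "s \<noteq> v" "t \<noteq> v"
      using that st assms(1) unfolding entry_colouring_def two_colouring_def by simp
    ultimately show "(col(v := b)) s \<noteq> (col(v := b)) t"
      using st nbr by (cases "s = v"; cases "t = v") auto
  qed
  moreover have "\<forall>u\<in>V. \<forall>c. N u c \<longrightarrow> c = (col(v := b)) u"
    using assms(1,4) unfolding entry_colouring_def moved_entries_def by auto
  ultimately show ?thesis unfolding entry_colouring_def by blast
qed

lemma entered_cut_off:
  assumes "entered E V N y" "symp E" "S \<subseteq> V - {y}" "boundary E V S = {v}"
  shows "entered E (insert v S) N v"
  unfolding entered_def
proof (intro conjI allI impI)
  show "connected_on E (insert v S)"
    using assms unfolding entered_def by (intro connected_on_insert_boundary[of E V]) auto
  fix T assume T: "T \<subseteq> insert v S - {v}" "T \<noteq> {}"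
  have "boundary E V T \<subseteq> boundary E (insert v S) T"
    using assms(4) T(1) unfolding boundary_def by blast
  moreover have "T \<subseteq> V - {y}" using T(1) assms(3) by auto
  ultimately show "(\<exists>u\<in>T. \<exists>c. N u c) \<or> (\<forall>q. \<not> boundary E (insert v S) T \<subseteq> {q})"
    using enteredD[OF assms(1) _ T(2)] by blast
qed simp

lemma entered_cut_rest:
  assumes "entered E V N y" "symp E" "N v b" "S \<subseteq> V - {y}" "boundary E V S = {v}"
  shows "entered E (V - S) N y"
  unfolding entered_def
proof (intro conjI allI impI)
  show "y \<in> V - S" using assms(1,4) unfolding entered_def by auto
  show "connected_on E (V - S)"
    using assms(1,5) unfolding entered_def
    by (intro connected_on_Diff[OF assms(2), of V S v]) (auto simp: boundary_def)
  fix T assume T: "T \<subseteq> V - S - {y}" "T \<noteq> {}"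
  show "(\<exists>u\<in>T. \<exists>c. N u c) \<or> (\<forall>q. \<not> boundary E (V - S) T \<subseteq> {q})"
  proof (cases "v \<in> T")
    case False
    have "boundary E V T \<inter> S = {}"
    proof (rule ccontr)
      assume "boundary E V T \<inter> S \<noteq> {}"
      then obtain u t where "u \<in> T" "t \<in> S" "E t u"
        using sympD[OF assms(2)] unfolding boundary_def by blast
      then have "u \<in> boundary E V S" using T(1) unfolding boundary_def by auto
      then show False using assms(5) False \<open>u \<in> T\<close> by auto
    qed
    then have "boundary E (V - S) T = boundary E V T" by (auto simp: boundary_Diff)
    moreover have "T \<subseteq> V - {y}" using T(1) by auto
    ultimately show ?thesis using enteredD[OF assms(1) _ T(2)] by simp
  qed (use assms(3) in blast)
qed

lemma entry_colouring_glue: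
  assumes "entry_colouring E (insert v S) N colS" "entry_colouring E (V - S) N colR" "N v b"
    and "symp E" "v \<in> V" "S \<subseteq> V" "boundary E V S \<subseteq> {v}"
  shows "entry_colouring E V N (\<lambda>t. if t \<in> insert v S then colS t else colR t)"
proof -
  have V: "insert v S \<union> (V - S) = V" using assms(5,6) by auto
  have agree: "colS t = colR t" if "t \<in> insert v S" "t \<in> V - S" for t
    using that assms(1-3) unfolding entry_colouring_def by auto
  have "s \<in> insert v S \<and> t \<in> insert v S \<or> s \<in> V - S \<and> t \<in> V - S"
    if "s \<in> V" "t \<in> V" "E s t" for s t
    using that assms(7) sympD[OF assms(4) that(3)] unfolding boundary_def by auto
  then have "two_colouring E (insert v S \<union> (V - S)) (\<lambda>t. if t \<in> insert v S then colS t else colR t)"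
    using assms(1,2) agree unfolding V entry_colouring_def
    by (intro two_colouring_glue[where A = "insert v S" and B = "V - S", unfolded V]) auto
  then show ?thesis using assms(1,2) unfolding V entry_colouring_def by auto
qed

lemma colouring_or_parities_cut:
  assumes "entered E V N y" "symp E" "N v b" "S \<subseteq> V - {y}" "boundary E V S = {v}"
    and "colouring_or_parities E (insert v S) N v" "colouring_or_parities E (V - S) N y"
  shows "colouring_or_parities E V N y"
proof -
  have v: "v \<in> V - S" using assms(5) unfolding boundary_def by auto
  then have V: "insert v S \<union> (V - S) = V" using assms(4) by auto
  obtain n where n: "spath E (V - S) v y n"
    using entered_joined[OF entered_cut_rest[OF assms(1-5)] v] unfolding joined_def by auto
  consider (parities_S) "\<forall>b. entry_parity E (insert v S) N v b"
    | (parities_rest) "\<forall>b. entry_parity E (V - S) N y b"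
    | (colourings) colS colR
      where "entry_colouring E (insert v S) N colS" "entry_colouring E (V - S) N colR"
    using assms(6,7) unfolding colouring_or_parities_def by blast
  then show ?thesis
  proof cases
    case parities_S
    have "insert v S \<inter> (V - S) \<subseteq> {v}" by auto
    then have "entry_parity E V N y ((b \<noteq> odd n) \<noteq> odd n)" for b
      using entry_parity_append[OF _ n] parities_S V by metis
    moreover have "((b \<noteq> odd n) \<noteq> odd n) = b" for b by auto
    ultimately have "entry_parity E V N y b" for b by simp
    then show ?thesis unfolding colouring_or_parities_def by blast
  next
    case parities_rest
    then show ?thesis
      using entry_parity_mono Diff_subset unfolding colouring_or_parities_def by metis
  next
    case colourings
    then show ?thesis
      using entry_colouring_glue[OF colourings assms(3,2)] v assms(4,5)
      unfolding colouring_or_parities_def by blast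
  qed
qed

lemma colouring_or_parities_both_labels:
  assumes "N v b" "N v (\<not> b)" "joined E V v y"
  shows "colouring_or_parities E V N y"
proof -
  obtain n where n: "spath E V v y n" using assms(3) unfolding joined_def by blast
  have "entry_parity E V N y p" for p
  proof -
    have "\<exists>c. N v c \<and> (p \<longleftrightarrow> c \<noteq> odd n)" using assms(1,2) by (cases "p = (b \<noteq> odd n)") auto
    then show ?thesis using n unfolding entry_parity_def by blast
  qed
  then show ?thesis unfolding colouring_or_parities_def by blast
qed

lemma colouring_or_parities_moved:
  assumes "colouring_or_parities E (V - {v}) (moved_entries E N v b) y" "symp E" "irreflp E"
    and "v \<in> V" "N v b" "\<And>c. N v c \<Longrightarrow> c = b"
  shows "colouring_or_parities E V N y"
proof -
  consider (colouring) col where "entry_colouring E (V - {v}) (moved_entries E N v b) col"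
    | (parities) "\<forall>p. entry_parity E (V - {v}) (moved_entries E N v b) y p"
    using assms(1) unfolding colouring_or_parities_def by blast
  then show ?thesis
  proof cases
    case colouring
    then have "entry_colouring E V N (col(v := b))"
      using assms(2,3,6) by (rule entry_colouring_moved)
    then show ?thesis unfolding colouring_or_parities_def by blast
  next
    case parities
    then have "entry_parity E V N y p" for p using assms(4,5) by (blast intro: entry_parity_moved)
    then show ?thesis unfolding colouring_or_parities_def by blast
  qed
qed

lemma entered_cut_vertex:
  assumes "entered E V N y" "symp E" "v \<noteq> y" "\<not> connected_on E (V - {v})"
  obtains S where "S \<subseteq> V - {y}" "S \<noteq> {}" "boundary E V S = {v}"
proof -
  have y: "y \<in> V" "connected_on E V" using assms(1) unfolding entered_def by auto
  obtain S where S: "S \<subseteq> V - {v} - {y}" "S \<noteq> {}" "boundary E (V - {v}) S = {}"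
    using connected_onI[OF assms(2), of y "V - {v}"] y(1) assms(3,4) by auto
  have "boundary E V S \<subseteq> {v}" using S(3) by (simp add: boundary_Diff)
  moreover have "boundary E V S \<noteq> {}" using S y(1) by (intro connected_on_boundary[OF y(2)]) auto
  ultimately show ?thesis using that[of S] S(1,2) by auto
qed

lemma entered_cases:
  assumes "entered E V N y" "symp E"
  obtains (singleton) "V = {y}"
    | (both_labels) v b where "v \<in> V" "N v b" "N v (\<not> b)"
    | (movable) v b where "v \<in> V - {y}" "N v b" "\<forall>c. N v c \<longrightarrow> c = b" "connected_on E (V - {v})"
    | (cut) v b S where "v \<in> V - {y}" "N v b" "S \<subseteq> V - {y}" "S \<noteq> {}" "boundary E V S = {v}"
proof (cases "V = {y}")
  case False
  obtain v b where v: "v \<in> V - {y}" "N v b" using entered_entry[OF assms(1) False] .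
  have label: "c = b" if "N v c" "\<not> N v (\<not> b)" for c using that by (cases b; cases c) auto
  consider "N v (\<not> b)" | "\<not> N v (\<not> b)" "connected_on E (V - {v})"
    | "\<not> connected_on E (V - {v})" by blast
  then show thesis
  proof cases
    case 1
    with _ v(2) show ?thesis by (rule both_labels) (use v(1) in auto)
  next
    case 2
    then have "\<forall>c. N v c \<longrightarrow> c = b" using label by simp
    with v show ?thesis using 2(2) by (rule movable)
  next
    case 3
    moreover have "v \<noteq> y" using v(1) by auto
    ultimately obtain S where "S \<subseteq> V - {y}" "S \<noteq> {}" "boundary E V S = {v}"
      using entered_cut_vertex[OF assms] by metis
    with v show ?thesis by (rule cut)
  qed
qed (rule singleton)

lemma colouring_or_parities_if_entered:
  assumes "finite V" "symp E" "irreflp E" "entered E V N y"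
  shows "colouring_or_parities E V N y"
  using assms(1,4)
proof (induction "card V" arbitrary: V N y rule: less_induct)
  case less
  note entered = less.prems(2)
  have IH: "colouring_or_parities E W M z" if "W \<subset> V" "entered E W M z" for W M z
  proof (rule less.hyps[OF _ _ that(2)])
    show "card W < card V" using less.prems(1) that(1) by (rule psubset_card_mono)
    show "finite W" using less.prems(1) that(1) by (auto intro: finite_subset)
  qed
  from entered assms(2) show ?case
  proof (cases rule: entered_cases)
    case singleton
    then show ?thesis using colouring_or_parities_singleton[OF assms(3)] by simp
  next
    case (both_labels v b)
    have "joined E V v y" using entered both_labels(1) by (rule entered_joined)
    with both_labels(2,3) show ?thesis by (rule colouring_or_parities_both_labels)
  next
    case (movable v b)
    have "entered E (V - {v}) (moved_entries E N v b) y"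
      using entered assms(2) _ movable(4) by (rule entered_moved) (use movable(1) in auto)
    then have "colouring_or_parities E (V - {v}) (moved_entries E N v b) y"
      using movable(1) by (intro IH) auto
    then show ?thesis
      using assms(2,3) _ movable(2)
      by (rule colouring_or_parities_moved) (use movable(1,3) in auto)
  next
    case (cut v b S)
    have "y \<in> V" using entered unfolding entered_def by auto
    then have "insert v S \<subset> V" "V - S \<subset> V" using cut(1,3,4) by auto
    then have "colouring_or_parities E (insert v S) N v" "colouring_or_parities E (V - S) N y"
      using entered_cut_off[OF entered assms(2) cut(3,5)]
        entered_cut_rest[OF entered assms(2) cut(2,3,5)]
      by (simp_all add: IH)
    then show ?thesis by (rule colouring_or_parities_cut[OF entered assms(2) cut(2,3,5)])
  qed
qed

lemma entered_root_nbrs: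
  assumes "symp E" "x \<in> V" "y \<in> V" "x \<noteq> y" "two_exits E V (V - {x, y})"
  shows "entered E (V - {x}) (\<lambda>u c. E x u \<and> c) y"
  unfolding entered_def
proof (intro conjI allI impI)
  have "two_exits E V (V - {y, x})" using assms(5) by (simp add: insert_commute)
  then show "connected_on E (V - {x})"
    using assms by (intro connected_on_if_two_exits[of E V y x]) auto
  fix S assume S: "S \<subseteq> V - {x} - {y}" "S \<noteq> {}"
  then have two: "\<not> boundary E V S \<subseteq> {q}" for q using two_exitsD[OF assms(5)] by blast
  show "(\<exists>u\<in>S. \<exists>c. E x u \<and> c) \<or> (\<forall>q. \<not> boundary E (V - {x}) S \<subseteq> {q})"
  proof (cases "\<exists>u\<in>S. E x u")
    case False
    then have "x \<notin> boundary E V S" using assms(1) unfolding boundary_def by (auto dest: sympD)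
    then have "boundary E (V - {x}) S = boundary E V S" by (simp add: boundary_Diff)
    then show ?thesis using two by simp
  qed auto
qed (use assms in auto)

lemma two_colouring_or_parities:
  assumes "finite V" "symp E" "irreflp E" "x \<in> V" "y \<in> V" "x \<noteq> y" "two_exits E V (V - {x, y})"
  shows "(\<exists>col. two_colouring E V col) \<or> (\<forall>b. \<exists>n. spath E V x y n \<and> odd n = b)"
proof -
  let ?N = "\<lambda>u c. E x u \<and> c"
  consider (colouring) col where "entry_colouring E (V - {x}) ?N col"
    | (parities) "\<forall>b. entry_parity E (V - {x}) ?N y b"
    using colouring_or_parities_if_entered[OF _ assms(2,3) entered_root_nbrs[OF assms(2,4-7)]]
      assms(1)
    unfolding colouring_or_parities_def by blast
  then show ?thesis
  proof cases
    case colouring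
    then have "two_colouring E V (col(x := False))"
      using assms(2,3) unfolding entry_colouring_def two_colouring_def
      by (auto dest: sympD irreflpD)
    then show ?thesis by blast
  next
    case parities
    have "\<exists>n. spath E V x y n \<and> odd n = b" for b
    proof -
      obtain u n where "E x u" "spath E (V - {x}) u y n" "b \<longleftrightarrow> even n"
        using parities unfolding entry_parity_def by blast
      then have "spath E V x y (Suc n)" "odd (Suc n) = b"
        using assms(4) by (auto intro: spath.step)
      then show ?thesis by blast
    qed
    then show ?thesis by blast
  qed
qed

section \<open>Graphs with a separating pair of vertices\<close>

definition has_cycle :: "('a \<Rightarrow> 'a \<Rightarrow> bool) \<Rightarrow> nat \<Rightarrow> bool" where
  "has_cycle E n \<longleftrightarrow> 3 \<le> n \<and> (\<exists>A u v. spath E A u v (n - 1) \<and> E v u)"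

definition consecutive_odd_cycles :: "('a \<Rightarrow> 'a \<Rightarrow> bool) \<Rightarrow> nat \<Rightarrow> bool" where
  "consecutive_odd_cycles E m \<longleftrightarrow> (\<exists>l. odd l \<and> (\<forall>i<m. has_cycle E (l + 2 * i)))"

lemma has_cycle_two_paths:
  assumes "symp E" "x \<noteq> y" "spath E A x y j" "spath E B x y k" "A \<inter> B \<subseteq> {x, y}" "3 \<le> j + k"
  shows "has_cycle E (j + k)"
proof -
  have "spath E B y x k" using assms(1,4) by (rule spath_rev)
  then obtain w i where w: "k = Suc i" "spath E (B - {x}) y w i" "E w x"
    using spath_split_last[OF assms(1) _ assms(2)[symmetric]] by metis
  have "spath E (A \<union> (B - {x})) x w (j + i)"
    using assms(3) w(2) by (rule spath_append) (use assms(5) in auto)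
  then show ?thesis using w(1,3) assms(6) unfolding has_cycle_def by auto
qed

locale separating_pair =
  fixes V :: "'a set" and E :: "'a \<Rightarrow> 'a \<Rightarrow> bool" and x y :: 'a and A B :: "'a set" and m :: nat
  assumes finite_V: "finite V" and symp_E: "symp E" and irreflp_E: "irreflp E" and m_pos: "0 < m"
    and V_eq: "V = A \<union> B \<union> {x, y}" and disjoint_A_B: "A \<inter> B = {}"
    and sides_nonempty: "A \<noteq> {}" "B \<noteq> {}"
    and x_neq_y: "x \<noteq> y" and roots_outside: "x \<notin> A \<union> B" "y \<notin> A \<union> B"
    and no_edge: "\<And>a b. a \<in> A \<Longrightarrow> b \<in> B \<Longrightarrow> \<not> E a b"
    and degree: "\<And>v. v \<in> V \<Longrightarrow> 2 * m \<le> card (nbrs V E v)"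
    and connected: "\<And>q. connected_on E (V - {q})"
begin

lemma swap: "separating_pair V E x y B A m"
  using finite_V symp_E irreflp_E m_pos V_eq disjoint_A_B sides_nonempty x_neq_y roots_outside
    no_edge degree connected
  by unfold_locales (auto dest: sympD)

lemma two_exits_side: "two_exits E V A"
  using connected _ _ x_neq_y
  by (rule two_exits_if_connected_on) (use V_eq roots_outside in auto)

lemma side_step: "u \<in> A \<Longrightarrow> t \<in> V \<Longrightarrow> E u t \<Longrightarrow> t \<in> A \<union> {x, y}"
  using no_edge V_eq by auto

lemma side_minus_roots: "A \<union> {x, y} - {x, y} = A"
  using roots_outside by auto

definition without_root_edge :: "'a \<Rightarrow> 'a \<Rightarrow> bool" where
  "without_root_edge u v \<longleftrightarrow> E u v \<and> {u, v} \<noteq> {x, y}"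

lemma without_root_edge_side: "u \<in> A \<Longrightarrow> E u t \<Longrightarrow> without_root_edge u t"
  using roots_outside unfolding without_root_edge_def by (auto simp: doubleton_eq_iff)

lemma rooted_side: "rooted_graph (A \<union> {x, y}) without_root_edge x y m"
proof -
  have "two_exits without_root_edge (A \<union> {x, y}) A"
    using two_exits_side by (rule two_exits_transfer) (use side_step without_root_edge_side in auto)
  moreover have "2 * m \<le> card (nbrs (A \<union> {x, y}) without_root_edge v)" if v: "v \<in> A" for v
  proof -
    have "nbrs (A \<union> {x, y}) without_root_edge v = nbrs V E v"
      using side_step[OF v] without_root_edge_side[OF v] V_eq
      unfolding nbrs_def without_root_edge_def by auto
    then show ?thesis using degree[of v] v V_eq by auto
  qed
  moreover have "symp without_root_edge" "irreflp without_root_edge"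
    using symp_E irreflp_E unfolding without_root_edge_def
    by (auto intro!: sympI irreflpI dest: sympD irreflpD simp: insert_commute)
  moreover have "finite (A \<union> {x, y})" "A \<union> {x, y} \<noteq> {x, y}"
    using finite_V V_eq sides_nonempty(1) roots_outside by auto
  ultimately show ?thesis
    unfolding rooted_graph_def side_minus_roots
    using x_neq_y by (auto simp: without_root_edge_def)
qed

lemma side_prog_paths:
  obtains l where "2 \<le> l" "\<forall>i<m. spath E (A \<union> {x, y}) x y (l + 2 * i)"
proof -
  let ?F = without_root_edge and ?A = "A \<union> {x, y}"
  obtain g where g: "g \<in> ?A - {y}" "?F g y" "prog_paths ?F (?A - {y}) x g m"
    using rooted_graph_shared_end_paths[OF rooted_side] unfolding shared_end_paths_def by auto
  have "spath ?F {g, y} g y 1" using g(1,2) by (intro spath_edge) auto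
  then have "prog_paths ?F (?A - {y} \<union> {g, y}) x y m" by (rule prog_paths_append[OF g(3)]) auto
  then have "prog_paths ?F ?A x y m" by (rule prog_paths_mono) (use g in auto)
  then obtain l where l: "\<forall>i<m. spath ?F ?A x y (l + 2 * i)" unfolding prog_paths_def by auto
  have "2 \<le> l"
    using l[rule_format, OF m_pos]
  proof cases
    case (step v k)
    have "k \<noteq> 0" using step(3,4) by (auto simp: without_root_edge_def elim: spath.cases)
    then show ?thesis using step(1) by simp
  qed (use x_neq_y in auto)
  moreover have "\<forall>i<m. spath E ?A x y (l + 2 * i)"
    using l spath_mono_rel[of ?F ?A x y _ E] unfolding without_root_edge_def by blast
  ultimately show ?thesis by (rule that)
qed

lemma consecutive_odd_cycles_if_return_path:
  assumes "2 \<le> l" "\<forall>i<m. spath E (A \<union> {x, y}) x y (l + 2 * i)"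
    and "spath E (B \<union> {x, y}) x y n" "odd (l + n)"
  shows "consecutive_odd_cycles E m"
proof -
  have "0 < n" using assms(3) x_neq_y by (auto elim: spath.cases intro: gr0I)
  have "has_cycle E (l + 2 * i + n)" if "i < m" for i
    using symp_E x_neq_y assms(2)[rule_format, OF that] assms(3)
    by (rule has_cycle_two_paths) (use disjoint_A_B assms(1) \<open>0 < n\<close> in auto)
  then have "has_cycle E (l + n + 2 * i)" if "i < m" for i using that by (simp add: ac_simps)
  then show ?thesis using assms(4) unfolding consecutive_odd_cycles_def by blast
qed

lemma two_colouring_side:
  assumes "\<not> consecutive_odd_cycles E m"
  obtains col where "two_colouring E (B \<union> {x, y}) col"
proof -
  obtain l where l: "2 \<le> l" "\<forall>i<m. spath E (A \<union> {x, y}) x y (l + 2 * i)"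
    using side_prog_paths .
  interpret swap: separating_pair V E x y B A m by (rule swap)
  have "two_exits E (B \<union> {x, y}) B"
    using swap.two_exits_side by (rule two_exits_transfer) (use swap.side_step in auto)
  then have "(\<exists>col. two_colouring E (B \<union> {x, y}) col) \<or>
      (\<forall>b. \<exists>n. spath E (B \<union> {x, y}) x y n \<and> odd n = b)"
    using finite_V V_eq x_neq_y swap.side_minus_roots
    by (intro two_colouring_or_parities[OF _ symp_E irreflp_E]) auto
  moreover have "even n \<longleftrightarrow> even l" if "spath E (B \<union> {x, y}) x y n" for n
    using consecutive_odd_cycles_if_return_path[OF l that] assms by auto
  ultimately show ?thesis using that by metis
qed

lemma consecutive_odd_cycles:
  assumes "\<nexists>col. two_colouring E V col"
  shows "consecutive_odd_cycles E m"
proof (rule ccontr)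
  assume none: "\<not> ?thesis"
  interpret swap: separating_pair V E x y B A m by (rule swap)
  obtain a where a: "2 \<le> a" "\<forall>i<m. spath E (A \<union> {x, y}) x y (a + 2 * i)"
    using side_prog_paths .
  obtain b where "\<forall>i<m. spath E (B \<union> {x, y}) x y (b + 2 * i)" using swap.side_prog_paths .
  then have b: "spath E (B \<union> {x, y}) x y b" using m_pos by force
  obtain colA where colA: "two_colouring E (A \<union> {x, y}) colA"
    using swap.two_colouring_side[OF none] .
  obtain colB where colB: "two_colouring E (B \<union> {x, y}) colB"
    using two_colouring_side[OF none] .
  have "even (a + b)"
    using consecutive_odd_cycles_if_return_path[OF a b] none by auto
  moreover have "odd a \<longleftrightarrow> colA x \<noteq> colA y"
    using spath_parity[OF a(2)[rule_format, OF m_pos] colA] by simp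
  moreover have "odd b \<longleftrightarrow> colB x \<noteq> colB y" using spath_parity[OF b colB] .
  ultimately have same: "colA x \<noteq> colA y \<longleftrightarrow> colB x \<noteq> colB y" by auto
  define colB' where "colB' t \<longleftrightarrow> colB t \<noteq> (colA x \<noteq> colB x)" for t
  have "two_colouring E (B \<union> {x, y}) colB'"
    using colB unfolding two_colouring_def colB'_def by auto
  moreover have "colA t = colB' t" if "t \<in> A \<union> {x, y}" "t \<in> B \<union> {x, y}" for t
    using that same disjoint_A_B unfolding colB'_def by auto
  moreover have "s \<in> A \<union> {x, y} \<and> t \<in> A \<union> {x, y} \<or> s \<in> B \<union> {x, y} \<and> t \<in> B \<union> {x, y}"
    if "s \<in> A \<union> {x, y} \<union> (B \<union> {x, y})" "t \<in> A \<union> {x, y} \<union> (B \<union> {x, y})" "E s t" for s t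
    using that no_edge sympD[OF symp_E that(3)] by auto
  ultimately have "two_colouring E (A \<union> {x, y} \<union> (B \<union> {x, y}))
      (\<lambda>t. if t \<in> A \<union> {x, y} then colA t else colB' t)"
    by (intro two_colouring_glue[OF colA])
  moreover have "A \<union> {x, y} \<union> (B \<union> {x, y}) = V" using V_eq by auto
  ultimately show False using assms by auto
qed

end

lemma consecutive_odd_cycles_if_card_3:
  assumes "card V = 3" "irreflp E" "0 < m" "\<And>v. v \<in> V \<Longrightarrow> 2 * m \<le> card (nbrs V E v)"
  shows "consecutive_odd_cycles E m"
proof -
  have fin: "finite V" using assms(1) card.infinite by fastforce
  have nbrs: "nbrs V E u \<subseteq> V - {u}" for u
    using assms(2) unfolding nbrs_def by (auto dest: irreflpD)
  have card: "card (V - {u}) = 2" if "u \<in> V" for u using assms(1) fin that by simp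
  obtain a b c where abc: "V = {a, b, c}" "a \<noteq> b" "b \<noteq> c" "a \<noteq> c"
    using assms(1) card_3_iff by metis
  have "2 * m \<le> 2"
    using assms(4)[of a] card_mono[OF _ nbrs[of a]] card[of a] fin abc(1) by auto
  then have m: "m = 1" using assms(3) by simp
  have "E u v" if uv: "u \<in> V" "v \<in> V" "u \<noteq> v" for u v
  proof -
    have "nbrs V E u = V - {u}"
      using nbrs[of u] assms(4)[OF uv(1)] card[OF uv(1)] m fin by (intro card_seteq) auto
    then show ?thesis using uv(2,3) unfolding nbrs_def by auto
  qed
  then have "spath E {a, b, c} a c (Suc (Suc 0))" "E c a"
    using abc by (auto intro!: spath.step[of a _ E b] spath.step[of b _ E c] spath.refl)
  then have "has_cycle E 3" unfolding has_cycle_def by (auto simp: numeral_2_eq_2)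
  then show ?thesis
    unfolding m consecutive_odd_cycles_def by (intro exI[of _ 3]) simp
qed

lemma consecutive_odd_cycles_if_separable:
  assumes "finite V" "symp E" "irreflp E" "0 < m" "\<And>v. v \<in> V \<Longrightarrow> 2 * m \<le> card (nbrs V E v)"
    and "\<nexists>col. two_colouring E V col" "3 < card V"
    and connected: "\<And>S. S \<subseteq> V \<Longrightarrow> card S < 2 \<Longrightarrow> connected_on E (V - S)"
    and S: "S \<subseteq> V" "card S < 3" "\<not> connected_on E (V - S)"
  shows "consecutive_odd_cycles E m"
proof -
  have "card S = 2" using connected[of S] S by (cases "card S < 2") auto
  then obtain x y where xy: "S = {x, y}" "x \<noteq> y" by (metis card_2_iff)
  have finS: "finite S" using S(1) assms(1) by (rule finite_subset)
  have "card (V - S) \<noteq> 0" using card_Diff_subset[OF finS S(1)] S(2) assms(7) by linarith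
  then have "V - S \<noteq> {}" by (metis card.empty)
  then obtain c where "c \<in> V - S" by blast
  then obtain A where A: "A \<subseteq> V - S - {c}" "A \<noteq> {}" "boundary E (V - S) A = {}"
    using connected_onI[OF assms(2)] S(3) by metis
  have "separating_pair V E x y A (V - S - A) m"
  proof
    show "V = A \<union> (V - S - A) \<union> {x, y}" using A(1) S(1) xy(1) by auto
    show "x \<notin> A \<union> (V - S - A)" "y \<notin> A \<union> (V - S - A)" using A(1) xy(1) by auto
    show "V - S - A \<noteq> {}" using \<open>c \<in> V - S\<close> A(1) by auto
    show "\<not> E a b" if "a \<in> A" "b \<in> V - S - A" for a b using A(3) that unfolding boundary_def by auto
    have "card (V \<inter> {q}) < 2" for q using card_mono[of "{q}" "V \<inter> {q}"] by auto
    then have "connected_on E (V - (V \<inter> {q}))" for q using connected by blast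
    then show "connected_on E (V - {q})" for q by (simp add: Diff_Int)
  qed (use assms(1-5) A(2) xy(2) in auto)
  then show ?thesis using assms(6) by (rule separating_pair.consecutive_odd_cycles)
qed

lemma consecutive_odd_cycles_if_not_3_connected:
  assumes "finite V" "symp E" "irreflp E" "0 < m" "\<And>v. v \<in> V \<Longrightarrow> 2 * m \<le> card (nbrs V E v)"
    and "\<nexists>col. two_colouring E V col" "2 < card V"
    and "\<And>S. S \<subseteq> V \<Longrightarrow> card S < 2 \<Longrightarrow> connected_on E (V - S)"
    and "\<not> (3 < card V \<and> (\<forall>S\<subseteq>V. card S < 3 \<longrightarrow> connected_on E (V - S)))"
  shows "consecutive_odd_cycles E m"
proof (cases "card V = 3")
  case True
  then show ?thesis using assms(3-5) by (rule consecutive_odd_cycles_if_card_3)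
next
  case False
  then have "3 < card V" using assms(7) by linarith
  moreover from this obtain S where "S \<subseteq> V" "card S < 3" "\<not> connected_on E (V - S)"
    using assms(9) by blast
  ultimately show ?thesis using assms(1-8) by (intro consecutive_odd_cycles_if_separable)
qed

section \<open>Translation to digraphs\<close>

abbreviation adjacent :: "'a pair_pre_digraph \<Rightarrow> 'a \<Rightarrow> 'a \<Rightarrow> bool" where
  "adjacent G u v \<equiv> (u, v) \<in> parcs G"

lemma bipartite_if_two_colouring:
  assumes "pair_wf_digraph G" "two_colouring (adjacent G) (pverts G) col"
  shows "bipartite (with_proj G)"
proof -
  interpret pair_wf_digraph G by (rule assms(1))
  have "parcs G \<subseteq> {v \<in> pverts G. col v} \<times> {v \<in> pverts G. \<not> col v}
      \<union> {v \<in> pverts G. \<not> col v} \<times> {v \<in> pverts G. col v}"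
    using assms(2) unfolding two_colouring_def by (auto dest: wellformed')
  then show ?thesis
    unfolding bipartite_def
    by (intro exI[of _ "{v \<in> pverts G. col v}"] exI[of _ "{v \<in> pverts G. \<not> col v}"]) auto
qed

context pair_graph
begin

lemma symp_adjacent: "symp (adjacent G)"
  using pair_sym_arcs unfolding symmetric_def by (auto intro!: sympI dest: symD)

lemma irreflp_adjacent: "irreflp (adjacent G)"
  by (auto intro!: irreflpI dest: pair_no_loops)

lemma out_degree_eq_card_nbrs:
  "out_degree (with_proj G) v = card (nbrs (pverts G) (adjacent G) v)"
proof -
  have "out_arcs (with_proj G) v = Pair v ` nbrs (pverts G) (adjacent G) v"
    unfolding out_arcs_def nbrs_def by (auto dest: in_arcsD2)
  then show ?thesis unfolding out_degree_def by (simp add: card_image inj_on_def)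
qed

lemma min_degree_le_card_nbrs:
  assumes "v \<in> pverts G"
  shows "min_degree (with_proj G) \<le> card (nbrs (pverts G) (adjacent G) v)"
  unfolding min_degree_def out_degree_eq_card_nbrs[symmetric]
  using assms pair_finite_verts by (intro Min_le) auto

lemma joined_iff_rtrancl_on:
  "joined (adjacent G) W u v \<longleftrightarrow> (u, v) \<in> rtrancl_on W ((arcs_ends (with_proj G \<restriction> W))\<^sup>s)"
proof -
  have arcs: "(a, b) \<in> (arcs_ends (with_proj G \<restriction> W))\<^sup>s \<longleftrightarrow> adjacent G a b \<and> a \<in> W \<and> b \<in> W" for a b
    using sympD[OF symp_adjacent, of b a]
    by (auto simp: arcs_ends_def arc_to_ends_def symcl_def)
  show ?thesis
  proof
    let ?C = "{b. (u, b) \<in> rtrancl_on W ((arcs_ends (with_proj G \<restriction> W))\<^sup>s)}"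
    assume joined: "joined (adjacent G) W u v"
    then have "u \<in> W" using spath_endpoints(1) unfolding joined_def by metis
    then have "u \<in> ?C" by simp
    with joined have "v \<in> ?C"
    proof (rule joined_closed)
      fix a b assume "a \<in> ?C" "b \<in> W" "adjacent G a b"
      moreover from this have "a \<in> W" using in_rtrancl_on_in_F by auto
      ultimately show "b \<in> ?C" using arcs rtrancl_on_into_rtrancl_on by fastforce
    qed
    then show "(u, v) \<in> rtrancl_on W ((arcs_ends (with_proj G \<restriction> W))\<^sup>s)" by simp
  next
    assume "(u, v) \<in> rtrancl_on W ((arcs_ends (with_proj G \<restriction> W))\<^sup>s)"
    then show "joined (adjacent G) W u v"
      by (induction rule: rtrancl_on_induct) (auto simp: arcs intro: joined_refl joined_extend)
  qed
qed

lemma connected_induced_iff: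
  "connected (with_proj G \<restriction> W) \<longleftrightarrow> W \<noteq> {} \<and> connected_on (adjacent G) W"
  unfolding connected_conv connected_on_def joined_iff_rtrancl_on by simp

lemma vertex_connected_iff:
  "vertex_connected k (with_proj G) \<longleftrightarrow> k < card (pverts G) \<and>
     (\<forall>S \<subseteq> pverts G. card S < k \<longrightarrow> connected_on (adjacent G) (pverts G - S))"
proof -
  have "pverts G - S \<noteq> {}" if "S \<subseteq> pverts G" "card S < k" "k < card (pverts G)" for S
    using that by auto
  then show ?thesis unfolding vertex_connected_def connected_induced_iff by auto
qed

lemma spath_imp_apath:
  assumes "spath (adjacent G) A u v n" "u \<in> pverts G"
  shows "\<exists>p. apath u p v \<and> length p = n \<and> set (awalk_verts u p) \<subseteq> A"
  using assms
proof (induction rule: spath.induct)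
  case (refl u A)
  then show ?case by (intro exI[of _ "[]"]) (simp add: apath_Nil_iff)
next
  case (step u A v w n)
  then obtain p where "apath v p w" "length p = n" "set (awalk_verts v p) \<subseteq> A - {u}"
    by (auto dest: in_arcsD2)
  then show ?case
    using step.hyps(1,2) by (intro exI[of _ "(u, v) # p"]) (auto simp: apath_Cons_iff)
qed

lemma has_cycle_imp_has_cycle_of_length:
  assumes "has_cycle (adjacent G) n"
  shows "has_cycle_of_length (with_proj G) n"
proof -
  obtain A u v where path: "3 \<le> n" "spath (adjacent G) A u v (n - 1)" "adjacent G v u"
    using assms unfolding has_cycle_def by blast
  then obtain p where p: "apath u p v" "length p = n - 1"
    using spath_imp_apath[OF path(2)] by (auto dest: in_arcsD2)
  then have "cycle ((v, u) # p)"
    using path(3) unfolding cycle_def apath_def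
    by (intro exI[of _ v]) (auto simp: awalk_Cons_iff)
  moreover have "length ((v, u) # p) = n" using p(2) path(1) by simp
  ultimately show ?thesis using path(1) unfolding has_cycle_of_length_def by blast
qed

end

theorem theorem1p4:
  fixes G :: "'a pair_pre_digraph" and k :: nat
  assumes "1 \<le> k"
    and "pair_graph G"
    and "vertex_connected 2 (with_proj G)"
    and "\<not> bipartite (with_proj G)"
    and "\<not> vertex_connected 3 (with_proj G)"
    and "k + 1 \<le> min_degree (with_proj G)"
  shows "\<exists>l :: nat. odd l \<and>
    (\<forall>i < nat \<lceil>real k / 2\<rceil>. has_cycle_of_length (with_proj G) (l + 2 * i))"
proof -
  interpret pair_graph G by (rule assms(2))
  define m where "m = nat \<lceil>real k / 2\<rceil>"
  have m: "2 * m \<le> k + 1" "0 < m" using assms(1) unfolding m_def by linarith+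
  have degree: "2 * m \<le> card (nbrs (pverts G) (adjacent G) v)" if "v \<in> pverts G" for v
    using min_degree_le_card_nbrs[OF that] assms(6) m(1) by linarith
  have nonbip: "\<nexists>col. two_colouring (adjacent G) (pverts G) col"
    using bipartite_if_two_colouring[OF pair_wf_digraph] assms(4) by blast
  have "consecutive_odd_cycles (adjacent G) m"
    using pair_finite_verts symp_adjacent irreflp_adjacent m(2) degree nonbip
    by (rule consecutive_odd_cycles_if_not_3_connected)
      (use assms(3,5) in \<open>auto simp: vertex_connected_iff\<close>)
  then show ?thesis
    using has_cycle_imp_has_cycle_of_length unfolding consecutive_odd_cycles_def m_def by blast
qed

end
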